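(* The $\tilde{\mathcal L}$-theory $T$ described below is complete.
   Context: Let $\mathcal L_0=\{P_i: i\in\omega\}\cup\{<_i:i\in\omega\}$ with $P_i$ unary and $<_i$ binary relation symbols. $T_0$ is the $\mathcal L_0$-theory with axioms: for all $i\neq j$, $P_i\cap P_j=\emptyset$; for all $i$: $<_i\subseteq P_i\times P_{i+1}$; $\forall x\in P_{i+1}\,\exists y\in P_i\,(y<_i x)$; $\forall x\forall x'\forall y((x<_i y\wedge x'<_i y)\to x=x')$. Let $(\mathcal M_i)_{i<\omega}$ list without repetition representatives of all isomorphism types of finite models of $T_0$. For $i,j\in\omega$ let $C_i^j$ be a set of $|M_i|$ new constant symbols (these sets pairwise disjoint), with a fixed bijection $e_i^j:C_i^j\to M_i$; let $C=\bigcup_{i,j}C_i^j$ and $\tilde{\mathcal L}=\mathcal L_0\cup C$. $T$ consists of: $T_0$; $c\neq d$ for distinct $c,d\in C$; for each $i,j$ the atomic and negated atomic $\mathcal L_0$-sentences making the substructure on $C_i^j$ isomorphic to $\mathcal M_i$ via $e_i^j$; and for each $i,j,k$: $\forall x\forall y\big((\bigvee_{c\in C_i^j}x=c)\wedge(x<_k y\vee y<_k x)\to\bigvee_{c\in C_i^j}y=c\big)$. *)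

theory Defs
  imports Main
begin

text \<open>
  First-order logic with equality over the relation symbols \<open>P\<^sub>i\<close> (unary) and \<open><\<^sub>i\<close> (binary),
  \<open>i \<in> \<omega>\<close>, and a set \<open>K\<close> of constant symbols taken from the type \<open>'c\<close>.  A language is determined
  by \<open>K\<close>: the base language is \<open>K = {}\<close>, its expansion by constants is \<open>K = C\<close>.
\<close>

datatype 'c tm = Var nat | Cst 'c

datatype 'c fm =
    Bot
  | Eq "'c tm" "'c tm"
  | Pr nat "'c tm"
  | Lt nat "'c tm" "'c tm"
  | Imp "'c fm" "'c fm"
  | All nat "'c fm"

abbreviation Neg :: "'c fm \<Rightarrow> 'c fm" where
  "Neg \<phi> \<equiv> Imp \<phi> Bot"
abbreviation Disj :: "'c fm \<Rightarrow> 'c fm \<Rightarrow> 'c fm" where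
  "Disj \<phi> \<psi> \<equiv> Imp (Neg \<phi>) \<psi>"
abbreviation Conj :: "'c fm \<Rightarrow> 'c fm \<Rightarrow> 'c fm" where
  "Conj \<phi> \<psi> \<equiv> Neg (Imp \<phi> (Neg \<psi>))"
abbreviation Ex :: "nat \<Rightarrow> 'c fm \<Rightarrow> 'c fm" where
  "Ex n \<phi> \<equiv> Neg (All n (Neg \<phi>))"

fun big_disj :: "'c fm list \<Rightarrow> 'c fm" where
  "big_disj [] = Bot"
| "big_disj (\<phi> # \<phi>s) = Disj \<phi> (big_disj \<phi>s)"

fun tm_vars :: "'c tm \<Rightarrow> nat set" where
  "tm_vars (Var n) = {n}"
| "tm_vars (Cst c) = {}"

fun free_vars :: "'c fm \<Rightarrow> nat set" where
  "free_vars Bot = {}"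
| "free_vars (Eq s t) = tm_vars s \<union> tm_vars t"
| "free_vars (Pr i t) = tm_vars t"
| "free_vars (Lt i s t) = tm_vars s \<union> tm_vars t"
| "free_vars (Imp \<phi> \<psi>) = free_vars \<phi> \<union> free_vars \<psi>"
| "free_vars (All n \<phi>) = free_vars \<phi> - {n}"

text \<open>\<open>set_fm \<phi>\<close> is the set of constant symbols occurring in \<open>\<phi>\<close>.\<close>

definition sentence :: "'c set \<Rightarrow> 'c fm \<Rightarrow> bool" where
  "sentence K \<phi> \<longleftrightarrow> free_vars \<phi> = {} \<and> set_fm \<phi> \<subseteq> K"

text \<open>
  The field \<open>cst\<close> is only meaningful on the constants \<open>K\<close> of the language at hand; for the base
  language (\<open>K = {}\<close>) it carries no information.
\<close>

record ('u, 'c) struc =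
  univ :: "'u set"
  prd :: "nat \<Rightarrow> 'u set"
  lt :: "nat \<Rightarrow> ('u \<times> 'u) set"
  cst :: "'c \<Rightarrow> 'u"

definition is_struc :: "'c set \<Rightarrow> ('u, 'c) struc \<Rightarrow> bool" where
  "is_struc K A \<longleftrightarrow>
     univ A \<noteq> {} \<and>
     (\<forall>i. prd A i \<subseteq> univ A) \<and>
     (\<forall>i. lt A i \<subseteq> univ A \<times> univ A) \<and>
     (\<forall>c\<in>K. cst A c \<in> univ A)"

fun tm_val :: "('u, 'c) struc \<Rightarrow> (nat \<Rightarrow> 'u) \<Rightarrow> 'c tm \<Rightarrow> 'u" where
  "tm_val A v (Var n) = v n"
| "tm_val A v (Cst c) = cst A c"

fun sat :: "('u, 'c) struc \<Rightarrow> (nat \<Rightarrow> 'u) \<Rightarrow> 'c fm \<Rightarrow> bool" where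
  "sat A v Bot \<longleftrightarrow> False"
| "sat A v (Eq s t) \<longleftrightarrow> tm_val A v s = tm_val A v t"
| "sat A v (Pr i t) \<longleftrightarrow> tm_val A v t \<in> prd A i"
| "sat A v (Lt i s t) \<longleftrightarrow> (tm_val A v s, tm_val A v t) \<in> lt A i"
| "sat A v (Imp \<phi> \<psi>) \<longleftrightarrow> (sat A v \<phi> \<longrightarrow> sat A v \<psi>)"
| "sat A v (All n \<phi>) \<longleftrightarrow> (\<forall>a\<in>univ A. sat A (v(n := a)) \<phi>)"

definition holds :: "('u, 'c) struc \<Rightarrow> 'c fm \<Rightarrow> bool" where
  "holds A \<phi> \<longleftrightarrow> (\<forall>v. range v \<subseteq> univ A \<longrightarrow> sat A v \<phi>)"

definition is_model :: "'c set \<Rightarrow> 'c fm set \<Rightarrow> ('u, 'c) struc \<Rightarrow> bool" where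
  "is_model K T A \<longleftrightarrow> is_struc K A \<and> (\<forall>\<phi>\<in>T. holds A \<phi>)"

text \<open>
  Semantic consequence, tested on all models whose universe is a set of elements of type \<open>'u\<close>.
\<close>

definition entails :: "'u itself \<Rightarrow> 'c set \<Rightarrow> 'c fm set \<Rightarrow> 'c fm \<Rightarrow> bool" where
  "entails (_ :: 'u itself) K T \<phi> \<longleftrightarrow>
     (\<forall>A :: ('u, 'c) struc. is_model K T A \<longrightarrow> holds A \<phi>)"

text \<open>
  A complete theory is a satisfiable theory that entails \<open>\<phi>\<close> or \<open>\<not> \<phi>\<close> for every sentence \<open>\<phi>\<close>.
  HOL cannot quantify over the universe type \<open>'u\<close> inside a definition, so it is a parameter, and a
  theorem should leave it a type variable.  Completeness for every type \<open>'u\<close> is completeness with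
  respect to all models: models over two different types \<open>'a\<close> and \<open>'b\<close> have isomorphic copies over
  \<open>'a + 'b\<close>.  Satisfiability cannot be asked for over \<open>'u\<close>, which may be finite.  A model on a set
  of natural numbers is the strongest form, and no restriction when the language is countable.
\<close>

definition complete_theory :: "'u itself \<Rightarrow> 'c set \<Rightarrow> 'c fm set \<Rightarrow> bool" where
  "complete_theory U K T \<longleftrightarrow>
     (\<exists>A :: (nat, 'c) struc. is_model K T A) \<and>
     (\<forall>\<phi>. sentence K \<phi> \<longrightarrow> entails U K T \<phi> \<or> entails U K T (Neg \<phi>))"

text \<open>Isomorphism of structures for the base language; constants are ignored.\<close>

definition isomorphic0 :: "('u, 'c) struc \<Rightarrow> ('w, 'c) struc \<Rightarrow> bool" where
  "isomorphic0 A B \<longleftrightarrow>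
     (\<exists>f. bij_betw f (univ A) (univ B) \<and>
        (\<forall>i. \<forall>a\<in>univ A. a \<in> prd A i \<longleftrightarrow> f a \<in> prd B i) \<and>
        (\<forall>i. \<forall>a\<in>univ A. \<forall>b\<in>univ A. (a, b) \<in> lt A i \<longleftrightarrow> (f a, f b) \<in> lt B i))"

definition T0 :: "'c fm set" where
  "T0 =
     {All 0 (Neg (Conj (Pr i (Var 0)) (Pr j (Var 0)))) | i j. i \<noteq> j} \<union>
     {All 0 (All 1 (Imp (Lt i (Var 0) (Var 1))
        (Conj (Pr i (Var 0)) (Pr (Suc i) (Var 1))))) | i. True} \<union>
     {All 0 (Imp (Pr (Suc i) (Var 0))
        (Ex 1 (Conj (Pr i (Var 1)) (Lt i (Var 1) (Var 0))))) | i. True} \<union>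
     {All 0 (All 1 (All 2 (Imp (Conj (Lt i (Var 0) (Var 2)) (Lt i (Var 1) (Var 2)))
        (Eq (Var 0) (Var 1))))) | i. True}"

definition finite_model_T0 :: "('u, 'c) struc \<Rightarrow> bool" where
  "finite_model_T0 A \<longleftrightarrow> is_model {} T0 A \<and> finite (univ A)"

text \<open>
  \<open>M\<close> lists, without repetition, representatives of all isomorphism types of finite models of \<open>T0\<close>.
  Every finite structure has an isomorphic copy on a set of natural numbers, so it is enough that
  the models \<open>A\<close> on such sets are represented.
\<close>

definition lists_finite_models :: "(nat \<Rightarrow> ('m, 'c) struc) \<Rightarrow> bool" where
  "lists_finite_models M \<longleftrightarrow>
     (\<forall>i. finite_model_T0 (M i)) \<and>
     (\<forall>i j. i \<noteq> j \<longrightarrow> \<not> isomorphic0 (M i) (M j)) \<and>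
     (\<forall>A :: (nat, 'c) struc. finite_model_T0 A \<longrightarrow> (\<exists>i. isomorphic0 A (M i)))"

text \<open>\<open>lit b \<phi>\<close> is \<open>\<phi>\<close> or its negation, according to the truth value \<open>b\<close>.\<close>

definition lit :: "bool \<Rightarrow> 'c fm \<Rightarrow> 'c fm" where
  "lit b \<phi> = (if b then \<phi> else Neg \<phi>)"

text \<open>
  \<open>diagram A D h\<close>: the atomic and negated atomic sentences expressing that \<open>h\<close> is an isomorphism
  from the substructure on the constants \<open>D\<close> to \<open>A\<close>.
\<close>

definition diagram :: "('m, 'c) struc \<Rightarrow> 'c set \<Rightarrow> ('c \<Rightarrow> 'm) \<Rightarrow> 'c fm set" where
  "diagram A D h =
     {lit (h c \<in> prd A k) (Pr k (Cst c)) | k c. c \<in> D} \<union>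
     {lit ((h c, h d) \<in> lt A k) (Lt k (Cst c) (Cst d)) | k c d. c \<in> D \<and> d \<in> D}"

definition one_of :: "nat \<Rightarrow> 'c list \<Rightarrow> 'c fm" where
  "one_of n cs = big_disj (map (\<lambda>c. Eq (Var n) (Cst c)) cs)"

definition closed_axiom :: "'c list \<Rightarrow> nat \<Rightarrow> 'c fm" where
  "closed_axiom cs k =
     All 0 (All 1 (Imp
       (Conj (one_of 0 cs) (Disj (Lt k (Var 0) (Var 1)) (Lt k (Var 1) (Var 0))))
       (one_of 1 cs)))"

text \<open>
  In the last group the disjunction over the finite set \<open>C i j\<close> is written out for each
  repetition-free enumeration \<open>cs\<close> of that set; these variants are logically equivalent.
\<close>

definition T_theory ::
  "(nat \<Rightarrow> ('m, 'c) struc) \<Rightarrow> (nat \<Rightarrow> nat \<Rightarrow> 'c set) \<Rightarrow> (nat \<Rightarrow> nat \<Rightarrow> 'c \<Rightarrow> 'm) \<Rightarrow> 'c fm set" where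
  "T_theory M C e =
     T0 \<union>
     {Neg (Eq (Cst c) (Cst d)) | c d. c \<in> (\<Union>i j. C i j) \<and> d \<in> (\<Union>i j. C i j) \<and> c \<noteq> d} \<union>
     (\<Union>i j. diagram (M i) (C i j) (e i j)) \<union>
     {closed_axiom cs k | i j k cs. distinct cs \<and> set cs = C i j}"

end

theory Submission
  imports Defs "HOL-Library.Nat_Bijection" "HOL-Library.Countable_Set"
begin

text \<open>
  A model of \<open>T\<^sub>0\<close> is a disjoint union of trees of height at most \<open>\<omega>\<close> and isolated points.  For a
  sentence of bounded quantifier rank that only mentions levels up to \<open>k\<close>, a node at level \<open>i\<close> is
  determined up to indistinguishability by a hereditary counting type of depth \<open>k - i\<close>: how many
  children it has of each type of depth \<open>k - i - 1\<close>, counted up to a cap \<open>n\<close>.  There are finitely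
  many types, so pruning a tree yields a finite tree whose root has the same type; this finite tree
  is some \<open>\<M>\<^sub>i\<close>, of which every model of \<open>T\<close> contains infinitely many closed copies.  Hence any two
  models of \<open>T\<close> realise each type of root infinitely often, and the duplicator wins every finite
  Ehrenfeucht-Fraisse game between them by keeping finite, ancestor-closed, type-preserving positions.
  The constants themselves form a model, which gives satisfiability.
\<close>

section \<open>Counting types of nodes\<close>

text \<open>The infinite case is split off because \<open>card\<close> is 0 there; it receives the
  cap, so the value \<open>n\<close> stands for at least \<open>n\<close> elements.\<close>

definition capped_card :: "nat \<Rightarrow> 'a set \<Rightarrow> nat" where
  "capped_card n X = (if finite X then min n (card X) else n)"

lemma capped_card_empty [simp]: "capped_card n {} = 0"
  by (simp add: capped_card_def)

lemma capped_card_le: "capped_card n X \<le> n"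
  by (simp add: capped_card_def)

lemma capped_card_image: "inj_on f X \<Longrightarrow> capped_card n (f ` X) = capped_card n X"
  by (simp add: capped_card_def card_image finite_image_iff)

text \<open>Any \<open>n\<close> elements of an infinite set already reach the cap; a finite set is
  its own witness.\<close>

lemma capped_card_subset_witness:
  "\<exists>W. W \<subseteq> X \<and> finite W \<and> capped_card n W = capped_card n X"
proof (cases "finite X")
  case False
  then obtain W where "W \<subseteq> X" "finite W" "card W = n"
    using infinite_arbitrarily_large by blast
  then show ?thesis using False by (intro exI[of _ W]) (simp add: capped_card_def)
qed blast

text \<open>One finite witness per fibre, united over the finitely many values of \<open>f\<close>.
  With \<open>f\<close> the type of a node, this thins out a set of children while keeping all type
  counts at once.\<close>

lemma capped_card_fibres_subset_witness:
  assumes "finite (range f)"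
  shows "\<exists>W. W \<subseteq> X \<and> finite W \<and>
    (\<forall>t. capped_card n {w \<in> W. f w = t} = capped_card n {w \<in> X. f w = t})"
proof -
  have "\<forall>t. \<exists>W. W \<subseteq> {w \<in> X. f w = t} \<and> finite W \<and> capped_card n W = capped_card n {w \<in> X. f w = t}"
    by (intro allI capped_card_subset_witness)
  from choice[OF this] obtain W where
    W: "\<forall>t. W t \<subseteq> {w \<in> X. f w = t} \<and> finite (W t) \<and> capped_card n (W t) = capped_card n {w \<in> X. f w = t}"
    ..
  have "{w \<in> \<Union>(W ` range f). f w = t} = W t" for t
  proof -
    have "f w = t'" if "w \<in> W t'" for w t' using W that by blast
    then show ?thesis by auto
  qed
  moreover have "finite (\<Union>(W ` range f))" using W assms by blast
  moreover have "\<Union>(W ` range f) \<subseteq> X" using W by blast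
  ultimately show ?thesis using W by (intro exI[of _ "\<Union>(W ` range f)"]) (simp del: UN_simps)
qed

text \<open>Types are coded as natural numbers so that nodes of structures over different HOL types
  can be compared. The map from a type \<open>t\<close> to its capped count is coded by the pairs
  below its graph, a finite set since only finitely many types occur. The child function
  \<open>ch\<close> is a parameter so that pruned trees can be measured too.\<close>

primrec ty :: "nat \<Rightarrow> ('a \<Rightarrow> 'a set) \<Rightarrow> nat \<Rightarrow> 'a \<Rightarrow> nat" where
  "ty n ch 0 = (\<lambda>a. 0)"
| "ty n ch (Suc d) = (\<lambda>a. set_encode (prod_encode `
     {(t, m). m < capped_card n {w \<in> ch a. ty n ch d w = t}}))"

lemma ty_Suc_set_subset:
  "{(t, m). m < capped_card n {w \<in> ch a. ty n ch d w = t}} \<subseteq> range (ty n ch d) \<times> {..<n}"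
proof clarsimp
  fix t m assume *: "m < capped_card n {w \<in> ch a. ty n ch d w = t}"
  then have "{w \<in> ch a. ty n ch d w = t} \<noteq> {}" by (metis capped_card_empty not_less0)
  then show "t \<in> range (ty n ch d) \<and> m < n"
    using * capped_card_le[of n "{w \<in> ch a. ty n ch d w = t}"] by auto
qed

text \<open>A code of depth \<open>Suc d\<close> encodes a subset of the grid of earlier types times
  \<open>{..<n}\<close>; the cap keeps this grid finite.\<close>

lemma finite_range_ty: "finite (range (ty n ch d))"
proof (induction d)
  case (Suc d)
  have "range (ty n ch (Suc d)) \<subseteq> set_encode ` (`) prod_encode ` Pow (range (ty n ch d) \<times> {..<n})"
    using ty_Suc_set_subset[of n ch _ d] by auto
  then show ?case by (rule finite_subset) (use Suc in simp)
qed simp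

lemma finite_ty_Suc_set: "finite {(t, m). m < capped_card n {w \<in> ch a. ty n ch d w = t}}"
  by (rule finite_subset[OF ty_Suc_set_subset]) (simp add: finite_range_ty)

text \<open>Both encodings are injective on the finite sets involved, and a count is recovered from
  the initial segment of numbers below it.\<close>

lemma ty_Suc_eq_iff:
  "ty n ch (Suc d) a = ty n ch' (Suc d) b \<longleftrightarrow>
   (\<forall>t. capped_card n {w \<in> ch a. ty n ch d w = t} = capped_card n {w \<in> ch' b. ty n ch' d w = t})"
  (is "?l \<longleftrightarrow> ?r")
proof
  let ?S = "\<lambda>ch a. {(t, m). m < capped_card n {w \<in> ch a. ty n ch d w = t}}"
  assume ?l
  then have "set_encode (prod_encode ` ?S ch a) = set_encode (prod_encode ` ?S ch' b)" by simp
  then have "prod_encode ` ?S ch a = prod_encode ` ?S ch' b"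
    by (rule inj_onD[OF inj_on_set_encode]) (simp_all add: finite_ty_Suc_set)
  then have "?S ch a = ?S ch' b" by (simp add: inj_image_eq_iff inj_prod_encode)
  then have less: "m < capped_card n {w \<in> ch a. ty n ch d w = t} \<longleftrightarrow>
      m < capped_card n {w \<in> ch' b. ty n ch' d w = t}" for t m
    by (auto simp: set_eq_iff)
  show ?r
  proof
    show "capped_card n {w \<in> ch a. ty n ch d w = t} = capped_card n {w \<in> ch' b. ty n ch' d w = t}"
      (is "?x = ?y") for t
      \<comment> \<open>Taking \<open>m\<close> to be either count shows that it is not the smaller
        one.\<close>
      using less[of ?x t] less[of ?y t] by simp
  qed
qed simp

text \<open>Types only look along children, so a map that carries child sets exactly to child sets
  on a child-closed set preserves them.\<close>

lemma ty_iso: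
  assumes "inj_on h S" "\<And>a. a \<in> S \<Longrightarrow> ch a \<subseteq> S" "\<And>a. a \<in> S \<Longrightarrow> ch' (h a) = h ` ch a"
    and "a \<in> S"
  shows "ty n ch' d (h a) = ty n ch d a"
  using \<open>a \<in> S\<close>
proof (induction d arbitrary: a)
  case (Suc d)
  have "{w \<in> ch' (h a). ty n ch' d w = t} = h ` {w \<in> ch a. ty n ch d w = t}" for t
  proof -
    have "w \<in> S" if "w \<in> ch a" for w using that Suc.prems assms(2) by blast
    then show ?thesis unfolding assms(3)[OF Suc.prems] using Suc.IH by auto
  qed
  moreover have "inj_on h {w \<in> ch a. ty n ch d w = t}" for t
    using assms(1,2) Suc.prems by (blast intro: inj_on_subset)
  ultimately show ?case unfolding ty_Suc_eq_iff by (simp add: capped_card_image)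
qed simp

section \<open>Forests\<close>

text \<open>Semantic form of \<open>T0\<close>; the level of the parent in the third clause comes
  from the second clause.\<close>

definition forest :: "('u, 'c) struc \<Rightarrow> bool" where
  "forest A \<longleftrightarrow>
     (\<forall>i j. i \<noteq> j \<longrightarrow> prd A i \<inter> prd A j = {}) \<and>
     (\<forall>i. lt A i \<subseteq> prd A i \<times> prd A (Suc i)) \<and>
     (\<forall>i. \<forall>x \<in> prd A (Suc i). \<exists>y. (y, x) \<in> lt A i) \<and>
     (\<forall>i x x' y. (x, y) \<in> lt A i \<longrightarrow> (x', y) \<in> lt A i \<longrightarrow> x = x')"

definition children :: "('u, 'c) struc \<Rightarrow> 'u \<Rightarrow> 'u set" where
  "children A a = {b. \<exists>i. (a, b) \<in> lt A i}"

lemma forest_level: "forest A \<Longrightarrow> a \<in> prd A i \<Longrightarrow> a \<in> prd A j \<Longrightarrow> i = j"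
  unfolding forest_def by blast

lemma forest_lt: "forest A \<Longrightarrow> (a, b) \<in> lt A i \<Longrightarrow> a \<in> prd A i \<and> b \<in> prd A (Suc i)"
  unfolding forest_def by blast

lemma forest_parent: "forest A \<Longrightarrow> a \<in> prd A (Suc i) \<Longrightarrow> \<exists>b. (b, a) \<in> lt A i"
  unfolding forest_def by blast

text \<open>The axiom compares edges with one index only; disjointness of levels first forces the
  two indices to agree.\<close>

lemma forest_parent_unique:
  assumes A: "forest A" and ac: "(a, c) \<in> lt A i" and bc: "(b, c) \<in> lt A j"
  shows "a = b \<and> i = j"
proof -
  have "Suc i = Suc j"
    using forest_level[OF A] forest_lt[OF A ac] forest_lt[OF A bc] by blast
  then show ?thesis using assms unfolding forest_def by blast
qed

lemma forest_children: "forest A \<Longrightarrow> a \<in> prd A i \<Longrightarrow> b \<in> children A a \<longleftrightarrow> (a, b) \<in> lt A i"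
  unfolding children_def using forest_lt[of A a b] forest_level[of A a i] by blast

text \<open>The universe is nonempty, so some assignment exists and \<open>holds\<close> collapses
  to the constant truth value.\<close>

lemma holds_iff:
  fixes A :: "('u, 'c) struc"
  assumes "is_struc K A" "\<And>v. sat A v \<phi> \<longleftrightarrow> b"
  shows "holds A \<phi> \<longleftrightarrow> b"
proof -
  obtain x where "x \<in> univ A" using assms(1) unfolding is_struc_def by blast
  then have "range (\<lambda>_ :: nat. x) \<subseteq> univ A" by blast
  then show ?thesis using assms(2) unfolding holds_def by blast
qed

lemma holds_T0_iff_forest:
  fixes A :: "('u, 'c) struc"
  assumes "is_struc K A"
  shows "(\<forall>\<phi>\<in>T0. holds A \<phi>) \<longleftrightarrow> forest A"
proof -
  have P: "prd A i \<subseteq> univ A" and L: "lt A i \<subseteq> univ A \<times> univ A" for i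
    using assms unfolding is_struc_def by blast+
  note h = holds_iff[OF assms]
  have 1: "holds A (All 0 (Neg (Conj (Pr i (Var 0)) (Pr j (Var 0))))) \<longleftrightarrow> prd A i \<inter> prd A j = {}" for i j
    by (rule h) (use P in auto)
  have 2: "holds A (All 0 (All 1 (Imp (Lt i (Var 0) (Var 1))
        (Conj (Pr i (Var 0)) (Pr (Suc i) (Var 1)))))) \<longleftrightarrow> lt A i \<subseteq> prd A i \<times> prd A (Suc i)" for i
    by (rule h) (use L[of i] in auto)
  have 4: "holds A (All 0 (All 1 (All 2 (Imp (Conj (Lt i (Var 0) (Var 2)) (Lt i (Var 1) (Var 2)))
        (Eq (Var 0) (Var 1)))))) \<longleftrightarrow> (\<forall>x x' y. (x, y) \<in> lt A i \<longrightarrow> (x', y) \<in> lt A i \<longrightarrow> x = x')" for i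
    by (rule h) (use L[of i] in \<open>auto 0 4\<close>)
  have 3: "holds A (All 0 (Imp (Pr (Suc i) (Var 0))
        (Ex 1 (Conj (Pr i (Var 1)) (Lt i (Var 1) (Var 0)))))) \<longleftrightarrow>
        (\<forall>x \<in> prd A (Suc i). \<exists>y \<in> prd A i. (y, x) \<in> lt A i)" for i
    by (rule h) (use P[of "Suc i"] P[of i] in \<open>simp, blast\<close>)
  have "(\<forall>\<phi>\<in>T0. holds A \<phi>) \<longleftrightarrow>
     (\<forall>i j. i \<noteq> j \<longrightarrow> prd A i \<inter> prd A j = {}) \<and>
     (\<forall>i. lt A i \<subseteq> prd A i \<times> prd A (Suc i)) \<and>
     (\<forall>i. \<forall>x \<in> prd A (Suc i). \<exists>y \<in> prd A i. (y, x) \<in> lt A i) \<and>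
     (\<forall>i x x' y. (x, y) \<in> lt A i \<longrightarrow> (x', y) \<in> lt A i \<longrightarrow> x = x')"
    unfolding T0_def 1[symmetric] 2[symmetric] 3[symmetric] 4[symmetric] by blast
  also have "\<dots> \<longleftrightarrow> forest A" unfolding forest_def by blast
  finally show ?thesis .
qed

section \<open>Pruning a tree to a finite one\<close>

text \<open>Each kept node keeps finitely many children that realise all capped counts of types one
  depth lower, and nothing is kept above level \<open>k\<close>. Induction on the remaining depth
  shows that the root keeps its type.\<close>

lemma forest_prune:
  assumes A: "forest A" and x: "x \<in> prd A 0"
  shows "\<exists>F. finite F \<and> x \<in> F \<and> F \<subseteq> (\<Union>i. prd A i) \<and>
    (\<forall>i y z. y \<in> F \<longrightarrow> (z, y) \<in> lt A i \<longrightarrow> z \<in> F) \<and>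
    ty n (\<lambda>z. children A z \<inter> F) k x = ty n (children A) k x"
proof -
  let ?good = "\<lambda>d z W. W \<subseteq> children A z \<and> finite W \<and>
      (\<forall>t. capped_card n {w \<in> W. ty n (children A) d w = t} =
           capped_card n {w \<in> children A z. ty n (children A) d w = t})"
  have "\<exists>W. ?good d z W" for d z
    by (rule capped_card_fibres_subset_witness[OF finite_range_ty])
  then have "\<forall>d. \<exists>W. \<forall>z. ?good d z (W z)"
    by (intro allI choice)
  from choice[OF this] obtain W where good: "\<forall>d z. ?good d z (W d z)" ..
  have W: "W d z \<subseteq> children A z" "finite (W d z)"
    "capped_card n {w \<in> W d z. ty n (children A) d w = t} =
           capped_card n {w \<in> children A z. ty n (children A) d w = t}" for d z t
    using good by (blast, blast, simp)
  \<comment> \<open>\<open>L l\<close> holds the kept nodes of level \<open>l\<close>. Depth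
    \<open>k - l\<close> remains there, so their children are selected for types of depth
    \<open>k - Suc l\<close>.\<close>
  define L where "L = rec_nat {x} (\<lambda>l S. if l < k then \<Union>z \<in> S. W (k - Suc l) z else {})"
  have L0: "L 0 = {x}" and LS: "L (Suc l) = (if l < k then \<Union>z \<in> L l. W (k - Suc l) z else {})" for l
    by (simp_all add: L_def)
  have finL: "finite (L l)" for l
    by (induction l) (auto simp: L0 LS W(2))
  have LP: "L l \<subseteq> prd A l" for l
  proof (induction l)
    case (Suc l)
    then show ?case
      using W(1) forest_children[OF A] forest_lt[OF A] by (fastforce simp: LS split: if_splits)
  qed (simp add: L0 x)
  have Lbig: "L l = {}" if "k < l" for l
    using that by (cases l) (auto simp: LS)
  define F where "F = (\<Union>l. L l)"
  have "F \<subseteq> (\<Union>l\<le>k. L l)"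
  proof
    fix y assume "y \<in> F"
    then obtain l where l: "y \<in> L l" unfolding F_def by blast
    then have "l \<le> k" using Lbig[of l] by (cases "k < l") auto
    then show "y \<in> (\<Union>l\<le>k. L l)" using l by blast
  qed
  then have "finite F" by (rule finite_subset) (simp add: finL)
  \<comment> \<open>The unique parent of a kept node is the kept node that selected it.\<close>
  have up: "z \<in> L i \<and> i < k \<and> y \<in> W (k - Suc i) z" if y: "y \<in> F" and zy: "(z, y) \<in> lt A i" for i y z
  proof -
    obtain l where l: "y \<in> L l" using y F_def by blast
    then have "l = Suc i" using LP forest_lt[OF A zy] forest_level[OF A] by blast
    then obtain z' where z': "z' \<in> L i" "y \<in> W (k - Suc i) z'" "i < k" using l LS by (auto split: if_splits)
    then have "(z', y) \<in> lt A i" using W(1) LP forest_children[OF A] by blast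
    then have "z' = z" using forest_parent_unique[OF A zy] by blast
    then show ?thesis using z' by blast
  qed
  have ty_F: "ty n (\<lambda>z. children A z \<inter> F) d z = ty n (children A) d z"
    if "z \<in> L l" "l + d = k" for d l z
    using that
  proof (induction d arbitrary: l z)
    case (Suc d)
    have d: "k - Suc l = d" "l < k" using Suc.prems by auto
    have z: "z \<in> prd A l" using Suc.prems LP by blast
    have WL: "W d z \<subseteq> L (Suc l)" unfolding LS using d Suc.prems(1) by auto
    have "w \<in> W d z" if "w \<in> children A z" "w \<in> F" for w
      using up[OF that(2), of z l] that(1) forest_children[OF A z] d by simp
    \<comment> \<open>A kept child was selected by its parent; conversely, selected children lie on
      the next kept level.\<close>
    then have "children A z \<inter> F = W d z"
      using W(1)[of d z] WL unfolding F_def by blast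
    moreover have "ty n (\<lambda>z. children A z \<inter> F) d w = ty n (children A) d w" if "w \<in> W d z" for w
      using Suc.IH[of w "Suc l"] WL Suc.prems(2) that by auto
    then have "{w \<in> W d z. ty n (\<lambda>z. children A z \<inter> F) d w = t} =
        {w \<in> W d z. ty n (children A) d w = t}" for t by auto
    \<comment> \<open>On the selected children pruned types are full types, and the choice of
      \<open>W\<close> makes their counts those of all children.\<close>
    ultimately show ?case unfolding ty_Suc_eq_iff using W(3) by simp
  qed simp
  have "ty n (\<lambda>z. children A z \<inter> F) k x = ty n (children A) k x"
    by (rule ty_F[of x 0]) (simp_all add: L0)
  moreover note \<open>finite F\<close>
  moreover have "x \<in> F" unfolding F_def using L0 by blast
  moreover have "F \<subseteq> (\<Union>i. prd A i)" unfolding F_def using LP by blast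
  moreover have "\<forall>i y z. y \<in> F \<longrightarrow> (z, y) \<in> lt A i \<longrightarrow> z \<in> F"
    using up unfolding F_def by blast
  ultimately show ?thesis by (intro exI[of _ F] conjI)
qed

section \<open>The back-and-forth argument\<close>

text \<open>Types are compared to depth \<open>k - i\<close>, what remains from level
  \<open>i\<close> to level \<open>k\<close>. Any two elements on no level up to \<open>k\<close>
  are alike.\<close>

definition alike :: "nat \<Rightarrow> nat \<Rightarrow> ('u, 'c) struc \<Rightarrow> ('w, 'c) struc \<Rightarrow> 'u \<Rightarrow> 'w \<Rightarrow> bool" where
  "alike n k A B a b \<longleftrightarrow>
     (\<forall>i\<le>k. (a \<in> prd A i \<longleftrightarrow> b \<in> prd B i) \<and>
       (a \<in> prd A i \<longrightarrow> ty n (children A) (k - i) a = ty n (children B) (k - i) b))"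

text \<open>Finite partial isomorphisms for levels up to \<open>k\<close>, kept as relations so that
  a converse swaps the structures. Closure under parents prevents a new element from being the
  parent of an old one. The indices \<open>i < k\<close> are those whose edges end at level
  \<open>k\<close> at most.\<close>

definition position :: "nat \<Rightarrow> nat \<Rightarrow> ('u, 'c) struc \<Rightarrow> ('w, 'c) struc \<Rightarrow> ('u \<times> 'w) set \<Rightarrow> bool" where
  "position n k A B R \<longleftrightarrow>
     finite R \<and> R \<subseteq> univ A \<times> univ B \<and>
     (\<forall>a b. (a, b) \<in> R \<longrightarrow> alike n k A B a b) \<and>
     (\<forall>a b a' b'. (a, b) \<in> R \<longrightarrow> (a', b') \<in> R \<longrightarrow>
        (a = a' \<longleftrightarrow> b = b') \<and> (\<forall>i<k. (a, a') \<in> lt A i \<longleftrightarrow> (b, b') \<in> lt B i)) \<and>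
     (\<forall>i<k. \<forall>a a'. (a, a') \<in> lt A i \<longrightarrow> a' \<in> Domain R \<longrightarrow> a \<in> Domain R) \<and>
     (\<forall>i<k. \<forall>b b'. (b, b') \<in> lt B i \<longrightarrow> b' \<in> Range R \<longrightarrow> b \<in> Range R)"

text \<open>In a forest, the condition on \<open>a\<close> selects the roots and the elements on no
  level up to \<open>k\<close>. A finite position cannot use up infinitely many twins.\<close>

definition rich :: "nat \<Rightarrow> nat \<Rightarrow> ('u, 'c) struc \<Rightarrow> ('w, 'c) struc \<Rightarrow> bool" where
  "rich n k A B \<longleftrightarrow> (\<forall>a \<in> univ A. (\<forall>i<k. \<forall>c. (c, a) \<notin> lt A i) \<longrightarrow>
     infinite {b \<in> univ B. alike n k A B a b})"

lemma alike_sym: "alike n k A B a b \<longleftrightarrow> alike n k B A b a"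
  unfolding alike_def by metis

lemma position_converse: "position n k A B R \<Longrightarrow> position n k B A (R\<inverse>)"
  unfolding position_def using alike_sym[of n k A B] by (simp, blast)

text \<open>A node with a parent in the position is matched by counting siblings of the same type; the
  cap \<open>n\<close> exceeds the number of siblings already used.\<close>

lemma position_free_twin:
  assumes A: "forest A" and B: "forest B" and uB: "\<And>i. lt B i \<subseteq> univ B \<times> univ B"
    and rich: "rich n k A B"
    and R: "position n k A B R" and n: "card R < n" and a: "a \<in> univ A" "a \<notin> Domain R"
    and parents: "\<forall>i<k. \<forall>c. (c, a) \<in> lt A i \<longrightarrow> c \<in> Domain R"
  shows "\<exists>b. b \<in> univ B \<and> b \<notin> Range R \<and> alike n k A B a b \<and>
    (\<forall>i<k. \<forall>c d. (c, d) \<in> R \<longrightarrow> (c, a) \<in> lt A i \<longrightarrow> (d, b) \<in> lt B i)"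
proof (cases "\<forall>i<k. \<forall>c. (c, a) \<notin> lt A i")
  case True
  have "finite (Range R)" using R unfolding position_def by (simp add: finite_Range)
  moreover have "infinite {b \<in> univ B. alike n k A B a b}" using rich a True unfolding rich_def by blast
  ultimately have "infinite ({b \<in> univ B. alike n k A B a b} - Range R)" by simp
  then obtain b where "b \<in> {b \<in> univ B. alike n k A B a b} - Range R"
    by (metis infinite_imp_nonempty ex_in_conv)
  then show ?thesis using True by blast
next
  case False
  then obtain i c where i: "i < k" and ca: "(c, a) \<in> lt A i" by blast
  then obtain d where cd: "(c, d) \<in> R" using parents by blast
  have Ri: "\<And>x y. (x, y) \<in> R \<Longrightarrow> alike n k A B x y"
    and Rp: "\<And>x y x' y'. (x, y) \<in> R \<Longrightarrow> (x', y') \<in> R \<Longrightarrow>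
        (x = x' \<longleftrightarrow> y = y') \<and> (\<forall>i<k. (x, x') \<in> lt A i \<longleftrightarrow> (y, y') \<in> lt B i)"
    and fin: "finite R"
    using R unfolding position_def by blast+
  have P: "c \<in> prd A i" "a \<in> prd A (Suc i)" using forest_lt[OF A ca] by auto
  then have d: "d \<in> prd B i"
    and tyeq: "ty n (children A) (k - i) c = ty n (children B) (k - i) d"
    using Ri[OF cd] i unfolding alike_def by auto
  \<comment> \<open>\<open>e\<close> is the depth left at level \<open>Suc i\<close>;
    \<open>X\<close> and \<open>Y\<close> collect the children of \<open>c\<close> and of its
    partner \<open>d\<close> that share the type of \<open>a\<close>.\<close>
  define e where "e = k - Suc i"
  define X where "X = {w \<in> children A c. ty n (children A) e w = ty n (children A) e a}"
  define Y where "Y = {w \<in> children B d. ty n (children B) e w = ty n (children A) e a}"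
  have ki: "k - i = Suc e" using i unfolding e_def by simp
  have XY: "capped_card n X = capped_card n Y"
    using tyeq[unfolded ki ty_Suc_eq_iff] unfolding X_def Y_def by blast
  have memX: "x \<in> X \<longleftrightarrow> (c, x) \<in> lt A i \<and> ty n (children A) e x = ty n (children A) e a" for x
    unfolding X_def using forest_children[OF A P(1)] by blast
  have memY: "y \<in> Y \<longleftrightarrow> (d, y) \<in> lt B i \<and> ty n (children B) e y = ty n (children A) e a" for y
    unfolding Y_def using forest_children[OF B d] by blast
  have xy: "x \<in> X \<longleftrightarrow> y \<in> Y" if xy: "(x, y) \<in> R" for x y
  proof -
    have "(c, x) \<in> lt A i \<longleftrightarrow> (d, y) \<in> lt B i" using Rp[OF cd xy] i by blast
    moreover have "ty n (children A) e x = ty n (children B) e y" if "(c, x) \<in> lt A i"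
      using Ri[OF xy] forest_lt[OF A that] i unfolding alike_def e_def by auto
    ultimately show ?thesis unfolding memX memY by auto
  qed
  \<comment> \<open>The used parts of \<open>X\<close> and \<open>Y\<close> are the two projections
    of \<open>?S\<close>, injective because \<open>R\<close> is a partial bijection; hence equally
    many are used on both sides.\<close>
  let ?S = "{p \<in> R. fst p \<in> X}"
  have X': "X \<inter> Domain R = fst ` ?S" by force
  have Y': "Y \<inter> Range R = snd ` ?S" using xy by force
  have cX: "card (X \<inter> Domain R) = card ?S" unfolding X'
    by (rule card_image) (use Rp in \<open>fastforce simp: inj_on_def\<close>)
  have cY: "card (Y \<inter> Range R) = card ?S" unfolding Y'
    by (rule card_image) (use Rp in \<open>fastforce simp: inj_on_def\<close>)
  have S: "card ?S < n" using card_mono[OF fin, of ?S] n by auto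
  have aX: "a \<in> X" unfolding memX using ca by simp
  \<comment> \<open>If all of \<open>Y\<close> were used, its capped count would be
    \<open>card ?S\<close>, below the cap and so exact. Then \<open>X\<close> would be used up as
    well, although \<open>a\<close> is not.\<close>
  have "\<not> Y \<subseteq> Range R"
  proof
    assume "Y \<subseteq> Range R"
    then have Y: "Y = Y \<inter> Range R" by blast
    then have finY: "finite Y" using fin by (metis finite_Int finite_Range)
    then have "capped_card n Y = card ?S" using S cY Y unfolding capped_card_def by simp
    then have "finite X" "card X = card ?S" using XY S unfolding capped_card_def by (auto split: if_splits)
    then have "X \<inter> Domain R = X" using cX by (intro card_subset_eq) auto
    then show False using aX a by blast
  qed
  then obtain b where b: "b \<in> Y" "b \<notin> Range R" by blast
  then have db: "(d, b) \<in> lt B i" and tyb: "ty n (children B) e b = ty n (children A) e a"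
    using memY by auto
  have bP: "b \<in> prd B (Suc i)" using forest_lt[OF B db] by blast
  have "a \<in> prd A j \<longleftrightarrow> j = Suc i" "b \<in> prd B j \<longleftrightarrow> j = Suc i" for j
    using forest_level[OF A P(2)] P(2) forest_level[OF B bP] bP by blast+
  then have "alike n k A B a b"
    unfolding alike_def using tyb e_def by simp
  \<comment> \<open>A parent of \<open>a\<close> must be \<open>c\<close>, so its partner must be
    \<open>d\<close>.\<close>
  moreover have "(d', b) \<in> lt B j" if "(c', d') \<in> R" "(c', a) \<in> lt A j" for j c' d'
    using forest_parent_unique[OF A ca that(2)] Rp[OF cd that(1)] db by blast
  ultimately show ?thesis using b uB[of i] db by blast
qed

text \<open>A free twin respects the edges from parents of \<open>a\<close>; edges out of the new
  pair to old elements are excluded by closure under parents, and loops by levels.\<close>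

lemma position_extend_one:
  assumes A: "forest A" and B: "forest B" and uB: "\<And>i. lt B i \<subseteq> univ B \<times> univ B"
    and rich: "rich n k A B"
    and R: "position n k A B R" and n: "card R < n" and a: "a \<in> univ A"
    and parents: "\<forall>i<k. \<forall>c. (c, a) \<in> lt A i \<longrightarrow> c \<in> Domain R"
  obtains b where "position n k A B (insert (a, b) R)"
proof (cases "a \<in> Domain R")
  case True
  then show ?thesis using R that by (metis DomainE insert_absorb)
next
  case False
  obtain b where b: "b \<in> univ B" "b \<notin> Range R" and ab: "alike n k A B a b"
    and par: "\<And>i c d. i < k \<Longrightarrow> (c, d) \<in> R \<Longrightarrow> (c, a) \<in> lt A i \<Longrightarrow> (d, b) \<in> lt B i"
    using position_free_twin[OF A B uB rich R n a False parents] by blast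
  have Rp: "\<And>x y x' y'. (x, y) \<in> R \<Longrightarrow> (x', y') \<in> R \<Longrightarrow>
        (x = x' \<longleftrightarrow> y = y') \<and> (\<forall>i<k. (x, x') \<in> lt A i \<longleftrightarrow> (y, y') \<in> lt B i)"
    and cA: "\<And>i x x'. i < k \<Longrightarrow> (x, x') \<in> lt A i \<Longrightarrow> x' \<in> Domain R \<Longrightarrow> x \<in> Domain R"
    and cB: "\<And>i y y'. i < k \<Longrightarrow> (y, y') \<in> lt B i \<Longrightarrow> y' \<in> Range R \<Longrightarrow> y \<in> Range R"
    using R unfolding position_def by blast+
  \<comment> \<open>Being alike puts \<open>a\<close> on the level of \<open>b\<close>, so
    \<open>a\<close> has a parent too. The partner of that parent is a parent of \<open>b\<close>,
    hence equals \<open>d\<close>.\<close>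
  have par_b: "\<exists>c. (c, d) \<in> R \<and> (c, a) \<in> lt A i" if i: "i < k" and db: "(d, b) \<in> lt B i" for i d
  proof -
    have "b \<in> prd B (Suc i)" using forest_lt[OF B db] by blast
    then have "a \<in> prd A (Suc i)" using ab i unfolding alike_def by auto
    then obtain c where ca: "(c, a) \<in> lt A i" using forest_parent[OF A] by blast
    then obtain d' where "(c, d') \<in> R" using parents i by blast
    moreover have "d' = d"
      using forest_parent_unique[OF B db par[OF i calculation ca]] by blast
    ultimately show ?thesis using ca by blast
  qed
  have new1: "(c, a) \<in> lt A i \<longleftrightarrow> (d, b) \<in> lt B i" if i: "i < k" and cd: "(c, d) \<in> R" for i c d
  proof
    assume "(d, b) \<in> lt B i"
    then obtain c' where "(c', d) \<in> R" "(c', a) \<in> lt A i" using par_b i by blast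
    then show "(c, a) \<in> lt A i" using Rp[OF cd, of c' d] by blast
  qed (use par i cd in blast)
  have new2: "(a, c) \<notin> lt A i" "(b, d) \<notin> lt B i" if "i < k" "(c, d) \<in> R" for i c d
    using cA[OF that(1), of a c] cB[OF that(1), of b d] that(2) False b by blast+
  have new3: "(a, a) \<notin> lt A i" "(b, b) \<notin> lt B i" for i
    using forest_lt[OF A, of a a i] forest_level[OF A, of a i "Suc i"]
      forest_lt[OF B, of b b i] forest_level[OF B, of b i "Suc i"] by auto
  have "position n k A B (insert (a, b) R)"
    unfolding position_def
  proof (intro conjI)
    show "finite (insert (a, b) R)" "insert (a, b) R \<subseteq> univ A \<times> univ B"
      "\<forall>x y. (x, y) \<in> insert (a, b) R \<longrightarrow> alike n k A B x y"
      using R a b ab unfolding position_def by auto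
    show "\<forall>x y x' y'. (x, y) \<in> insert (a, b) R \<longrightarrow> (x', y') \<in> insert (a, b) R \<longrightarrow>
        (x = x' \<longleftrightarrow> y = y') \<and> (\<forall>i<k. (x, x') \<in> lt A i \<longleftrightarrow> (y, y') \<in> lt B i)"
    proof (intro allI impI)
      fix x y x' y' assume h: "(x, y) \<in> insert (a, b) R" "(x', y') \<in> insert (a, b) R"
      then consider "(x, y) \<in> R" "(x', y') \<in> R" | "x = a" "y = b" "(x', y') \<in> R"
        | "x' = a" "y' = b" "(x, y) \<in> R" | "x = a" "y = b" "x' = a" "y' = b" by blast
      then show "(x = x' \<longleftrightarrow> y = y') \<and> (\<forall>i<k. (x, x') \<in> lt A i \<longleftrightarrow> (y, y') \<in> lt B i)"
      proof cases
        case 1 then show ?thesis by (rule Rp)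
      next
        case 2 then show ?thesis using False b new2 by blast
      next
        case 3 then show ?thesis using False b new1 by blast
      next
        case 4 then show ?thesis using new3 by blast
      qed
    qed
    show "\<forall>i<k. \<forall>x x'. (x, x') \<in> lt A i \<longrightarrow> x' \<in> Domain (insert (a, b) R) \<longrightarrow> x \<in> Domain (insert (a, b) R)"
      using cA parents by auto
    show "\<forall>i<k. \<forall>y y'. (y, y') \<in> lt B i \<longrightarrow> y' \<in> Range (insert (a, b) R) \<longrightarrow> y \<in> Range (insert (a, b) R)"
      using cB par_b by (auto, blast)
  qed
  then show ?thesis by (rule that)
qed

text \<open>The branch from the root to \<open>a\<close> is added parent first, which costs at most
  \<open>Suc i\<close> pairs.\<close>

lemma position_extend_level:
  assumes A: "forest A" and B: "forest B"
    and uA: "\<And>i. lt A i \<subseteq> univ A \<times> univ A" and uB: "\<And>i. lt B i \<subseteq> univ B \<times> univ B"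
    and rich: "rich n k A B"
    and R: "position n k A B R" and i: "i \<le> k" and n: "card R + Suc i \<le> n"
    and a: "a \<in> univ A" "a \<in> prd A i"
  shows "\<exists>R' b. R \<subseteq> R' \<and> position n k A B R' \<and> (a, b) \<in> R' \<and> card R' \<le> card R + Suc i"
  using i n a
proof (induction i arbitrary: a)
  case 0
  have "\<forall>i<k. \<forall>c. (c, a) \<in> lt A i \<longrightarrow> c \<in> Domain R"
    using forest_lt[OF A, of _ a] forest_level[OF A, of a 0] 0 by fastforce
  moreover have "card R < n" using 0 by simp
  ultimately obtain b where "position n k A B (insert (a, b) R)"
    using position_extend_one[OF A B uB rich R] 0 by blast
  moreover have "card (insert (a, b) R) \<le> card R + Suc 0"
    using R by (simp add: position_def card_insert_if)
  ultimately show ?case by blast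
next
  case (Suc i)
  obtain c where ca: "(c, a) \<in> lt A i" using forest_parent[OF A Suc.prems(4)] by blast
  then have "c \<in> univ A" "c \<in> prd A i" using uA forest_lt[OF A ca] by blast+
  then obtain R' d where R': "R \<subseteq> R'" "position n k A B R'" "(c, d) \<in> R'" "card R' \<le> card R + Suc i"
    using Suc.IH[of c] Suc.prems by auto
  have "\<forall>j<k. \<forall>c. (c, a) \<in> lt A j \<longrightarrow> c \<in> Domain R'"
    using forest_parent_unique[OF A ca] R'(3) by blast
  moreover have "card R' < n" using R' Suc.prems by simp
  ultimately obtain b where "position n k A B (insert (a, b) R')"
    using position_extend_one[OF A B uB rich R'(2)] Suc.prems by blast
  moreover have "card (insert (a, b) R') \<le> card R + Suc (Suc i)"
    using R' by (simp add: position_def card_insert_if)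
  ultimately show ?case using R'(1) by blast
qed

text \<open>An element on no level up to \<open>k\<close> has no parent through an index below
  \<open>k\<close> and is added alone; so every move costs at most \<open>Suc k\<close>
  pairs.\<close>

lemma position_extend:
  assumes A: "forest A" and B: "forest B"
    and uA: "\<And>i. lt A i \<subseteq> univ A \<times> univ A" and uB: "\<And>i. lt B i \<subseteq> univ B \<times> univ B"
    and rich: "rich n k A B"
    and R: "position n k A B R" and n: "card R + Suc k \<le> n" and a: "a \<in> univ A"
  shows "\<exists>R' b. R \<subseteq> R' \<and> position n k A B R' \<and> (a, b) \<in> R' \<and> card R' \<le> card R + Suc k"
proof (cases "\<exists>i\<le>k. a \<in> prd A i")
  case True
  then obtain i where i: "i \<le> k" "a \<in> prd A i" by blast
  moreover have "card R + Suc i \<le> n" using n i by simp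
  ultimately obtain R' b where "R \<subseteq> R'" "position n k A B R'" "(a, b) \<in> R'" "card R' \<le> card R + Suc i"
    using position_extend_level[OF A B uA uB rich R] a by blast
  moreover have "card R + Suc i \<le> card R + Suc k" using i by simp
  ultimately show ?thesis by (meson le_trans)
next
  case False
  have "\<forall>i<k. \<forall>c. (c, a) \<in> lt A i \<longrightarrow> c \<in> Domain R"
    using forest_lt[OF A, of _ a] False Suc_leI by blast
  moreover have "card R < n" using n by simp
  ultimately obtain b where "position n k A B (insert (a, b) R)"
    using position_extend_one[OF A B uB rich R] a by blast
  moreover have "card (insert (a, b) R) \<le> card R + Suc k"
    using R by (simp add: position_def card_insert_if)
  ultimately show ?thesis by blast
qed

section \<open>From positions to truth of formulas\<close>

fun qrank :: "'c fm \<Rightarrow> nat" where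
  "qrank (Imp \<phi> \<psi>) = max (qrank \<phi>) (qrank \<psi>)"
| "qrank (All m \<phi>) = Suc (qrank \<phi>)"
| "qrank _ = 0"

text \<open>An edge of index \<open>i\<close> reaches level \<open>Suc i\<close>; this bound gives
  the \<open>i < k\<close> that positions ask for.\<close>

fun level_bound :: "'c fm \<Rightarrow> nat" where
  "level_bound (Pr i t) = i"
| "level_bound (Lt i s t) = Suc i"
| "level_bound (Imp \<phi> \<psi>) = max (level_bound \<phi>) (level_bound \<psi>)"
| "level_bound (All m \<phi>) = level_bound \<phi>"
| "level_bound _ = 0"

text \<open>The Ehrenfeucht-Fraisse argument: \<open>n\<close> is a budget of pairs from which each
  remaining quantifier may draw \<open>Suc k\<close>.\<close>

lemma position_sat_iff:
  fixes A :: "('u, 'c) struc" and B :: "('w, 'c) struc"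
  assumes A: "forest A" and B: "forest B"
    and uA: "\<And>i. lt A i \<subseteq> univ A \<times> univ A" and uB: "\<And>i. lt B i \<subseteq> univ B \<times> univ B"
    and AB: "rich n k A B" and BA: "rich n k B A"
    and "position n k A B R" "card R + qrank \<phi> * Suc k \<le> n" "level_bound \<phi> \<le> k"
    and "\<And>c. c \<in> set_fm \<phi> \<Longrightarrow> (cst A c, cst B c) \<in> R"
    and "\<And>x. x \<in> free_vars \<phi> \<Longrightarrow> (v x, w x) \<in> R"
  shows "sat A v \<phi> \<longleftrightarrow> sat B w \<phi>"
  using assms(7-)
proof (induction \<phi> arbitrary: R v w)
  case (Eq s t)
  have "(tm_val A v s, tm_val B w s) \<in> R" "(tm_val A v t, tm_val B w t) \<in> R"
    using Eq by (cases s; cases t; auto)+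
  then show ?case using Eq(1) unfolding position_def sat.simps by blast
next
  case (Pr i t)
  have "(tm_val A v t, tm_val B w t) \<in> R"
    using Pr by (cases t) auto
  then show ?case using Pr(1,3) unfolding position_def alike_def by simp
next
  case (Lt i s t)
  have "(tm_val A v s, tm_val B w s) \<in> R" "(tm_val A v t, tm_val B w t) \<in> R"
    using Lt by (cases s; cases t; auto)+
  then show ?case using Lt(1,3) unfolding position_def by simp
next
  case (Imp \<phi> \<psi>)
  have "qrank \<phi> * Suc k \<le> qrank (Imp \<phi> \<psi>) * Suc k" "qrank \<psi> * Suc k \<le> qrank (Imp \<phi> \<psi>) * Suc k"
    by (intro mult_le_mono1; simp)+
  then have "card R + qrank \<phi> * Suc k \<le> n" "card R + qrank \<psi> * Suc k \<le> n"
    using Imp.prems(2) by linarith+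
  then have "sat A v \<phi> \<longleftrightarrow> sat B w \<phi>" "sat A v \<psi> \<longleftrightarrow> sat B w \<psi>"
    using Imp.prems by (intro Imp.IH[of R]; simp)+
  then show ?case by simp
next
  case (All m \<phi>)
  \<comment> \<open>The budget splits into the cost of this move and the reserve for
    \<open>\<phi>\<close>.\<close>
  have n: "card R + Suc k \<le> n" "card R + Suc k + qrank \<phi> * Suc k \<le> n" using All.prems(2) by auto
  have step: "sat A (v(m := a)) \<phi> \<longleftrightarrow> sat B (w(m := b)) \<phi>"
    if "R \<subseteq> R'" "position n k A B R'" "(a, b) \<in> R'" "card R' \<le> card R + Suc k" for R' a b
    using that n All.prems(3-) by (intro All.IH[of R']) auto
  have left_to_right: "\<exists>b \<in> univ B. sat A (v(m := a)) \<phi> \<longleftrightarrow> sat B (w(m := b)) \<phi>" if a: "a \<in> univ A" for a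
  proof -
    obtain R' b where R': "R \<subseteq> R'" "position n k A B R'" "(a, b) \<in> R'" "card R' \<le> card R + Suc k"
      using position_extend[OF A B uA uB AB All.prems(1) n(1) a] by blast
    moreover have "b \<in> univ B" using R'(2,3) unfolding position_def by blast
    ultimately show ?thesis using step by blast
  qed
  have right_to_left: "\<exists>a \<in> univ A. sat A (v(m := a)) \<phi> \<longleftrightarrow> sat B (w(m := b)) \<phi>" if b: "b \<in> univ B" for b
  proof -
    \<comment> \<open>A move in \<open>B\<close> is answered by extending the converse
      position.\<close>
    have "card (R\<inverse>) + Suc k \<le> n" using n(1) by simp
    then obtain R' a where R': "R\<inverse> \<subseteq> R'" "position n k B A R'" "(b, a) \<in> R'" "card R' \<le> card (R\<inverse>) + Suc k"
      using position_extend[OF B A uB uA BA position_converse[OF All.prems(1)] _ b] by blast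
    have "R \<subseteq> R'\<inverse>" "(a, b) \<in> R'\<inverse>" "card (R'\<inverse>) \<le> card R + Suc k" "position n k A B (R'\<inverse>)"
      using R' position_converse[OF R'(2)] by auto
    moreover have "a \<in> univ A" using R'(2,3) unfolding position_def by blast
    ultimately show ?thesis using step by blast
  qed
  show ?case using left_to_right right_to_left by (simp, blast)
qed simp

section \<open>Models of the theory\<close>

text \<open>Used to move finite models and the countable model onto natural numbers.\<close>

definition map_struc :: "('u \<Rightarrow> 'w) \<Rightarrow> ('u, 'c) struc \<Rightarrow> ('w, 'c) struc" where
  "map_struc g A = \<lparr>univ = g ` univ A, prd = (\<lambda>i. g ` prd A i),
     lt = (\<lambda>i. map_prod g g ` lt A i), cst = (\<lambda>c. g (cst A c))\<rparr>"

lemma map_struc_simps [simp]: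
  "univ (map_struc g A) = g ` univ A" "cst (map_struc g A) = (\<lambda>c. g (cst A c))"
  by (simp_all add: map_struc_def)

lemma is_struc_map: "is_struc K A \<Longrightarrow> is_struc K (map_struc g A)"
  unfolding is_struc_def map_struc_def by fastforce

lemma map_struc_prd:
  assumes "is_struc K A" "inj_on g (univ A)" "a \<in> univ A"
  shows "g a \<in> prd (map_struc g A) i \<longleftrightarrow> a \<in> prd A i"
  using assms unfolding is_struc_def map_struc_def by (simp add: inj_on_image_mem_iff)

lemma map_struc_lt:
  assumes "is_struc K A" "inj_on g (univ A)" "a \<in> univ A" "b \<in> univ A"
  shows "(g a, g b) \<in> lt (map_struc g A) i \<longleftrightarrow> (a, b) \<in> lt A i"
proof
  assume "(g a, g b) \<in> lt (map_struc g A) i"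
  then obtain a' b' where "(a', b') \<in> lt A i" "g a = g a'" "g b = g b'"
    unfolding map_struc_def by auto
  moreover have "a' \<in> univ A" "b' \<in> univ A" using calculation(1) assms(1) unfolding is_struc_def by blast+
  ultimately show "(a, b) \<in> lt A i" using assms(2-) by (metis inj_onD)
qed (force simp: map_struc_def)

lemma is_struc_lt_univ:
  assumes "is_struc K A" "(a, b) \<in> lt A i"
  shows "a \<in> univ A" "b \<in> univ A"
  using assms unfolding is_struc_def by blast+

lemma is_struc_prd_univ: "is_struc K A \<Longrightarrow> a \<in> prd A i \<Longrightarrow> a \<in> univ A"
  unfolding is_struc_def by blast

lemma forest_map:
  assumes s: "is_struc K A" and g: "inj_on g (univ A)" and A: "forest A"
  shows "forest (map_struc g A)"
proof -
  let ?B = "map_struc g A"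
  have sB: "is_struc K ?B" by (rule is_struc_map[OF s])
  note prd = map_struc_prd[OF s g] and lt = map_struc_lt[OF s g]
  have prd_E: "\<exists>a \<in> univ A. x = g a \<and> a \<in> prd A i" if "x \<in> prd ?B i" for x i
    using that is_struc_prd_univ[OF s, of _ i] unfolding map_struc_def by auto
  have lt_E: "\<exists>a \<in> univ A. \<exists>b \<in> univ A. x = g a \<and> y = g b \<and> (a, b) \<in> lt A i" if "(x, y) \<in> lt ?B i" for x y i
    using that is_struc_lt_univ[OF s, of _ _ i] unfolding map_struc_def by fastforce
  show ?thesis
    unfolding forest_def
  proof (intro conjI allI impI ballI subsetI)
    fix i j :: nat assume "i \<noteq> j"
    then show "prd ?B i \<inter> prd ?B j = {}"
      using prd_E[of _ i] prd forest_level[OF A, of _ i j] by blast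
  next
    fix i p assume "p \<in> lt ?B i"
    then obtain a b where ab: "a \<in> univ A" "b \<in> univ A" "p = (g a, g b)" "(a, b) \<in> lt A i"
      using lt_E[of "fst p" "snd p" i] by (metis prod.collapse)
    then show "p \<in> prd ?B i \<times> prd ?B (Suc i)"
      using forest_lt[OF A ab(4)] by (simp add: prd)
  next
    fix i x assume "x \<in> prd ?B (Suc i)"
    then obtain a where a: "a \<in> univ A" "x = g a" "a \<in> prd A (Suc i)" using prd_E by blast
    then obtain b where "(b, a) \<in> lt A i" using forest_parent[OF A] by blast
    then show "\<exists>y. (y, x) \<in> lt ?B i" unfolding a(2) map_struc_def by force
  next
    fix i x x' y assume h: "(x, y) \<in> lt ?B i" "(x', y) \<in> lt ?B i"
    obtain a b where a: "a \<in> univ A" "b \<in> univ A" "x = g a" "y = g b" "(a, b) \<in> lt A i"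
      using lt_E[OF h(1)] by blast
    obtain a' b' where a': "a' \<in> univ A" "b' \<in> univ A" "x' = g a'" "y = g b'" "(a', b') \<in> lt A i"
      using lt_E[OF h(2)] by blast
    have "b' = b" using g a a' by (metis inj_onD)
    then have "a = a'" using forest_parent_unique[OF A a(5)] a'(5) by blast
    then show "x = x'" using a a' by simp
  qed
qed

lemma sat_one_of: "sat A v (one_of x cs) \<longleftrightarrow> v x \<in> cst A ` set cs"
  unfolding one_of_def by (induction cs) auto

lemma holds_lit:
  assumes "is_struc K A" "\<And>v. sat A v \<phi> \<longleftrightarrow> p"
  shows "holds A (lit b \<phi>) \<longleftrightarrow> (p \<longleftrightarrow> b)"
  by (rule holds_iff[OF assms(1)]) (use assms(2) in \<open>auto simp: lit_def\<close>)

section \<open>Semantic form of the theory\<close>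

locale finite_model_copies =
  fixes M :: "nat \<Rightarrow> ('m, 'c) struc"
    and C :: "nat \<Rightarrow> nat \<Rightarrow> 'c set"
    and e :: "nat \<Rightarrow> nat \<Rightarrow> 'c \<Rightarrow> 'm"
  assumes listing: "lists_finite_models M"
    and copy_bij: "\<And>i j. bij_betw (e i j) (C i j) (univ (M i))"
    and copies_disjoint: "\<And>i j i' j'. (i, j) \<noteq> (i', j') \<Longrightarrow> C i j \<inter> C i' j' = {}"
begin

lemma M_struc: "is_struc {} (M i)" and M_forest: "forest (M i)" and M_finite: "finite (univ (M i))"
  using listing holds_T0_iff_forest[of "{}" "M i"]
  unfolding lists_finite_models_def finite_model_T0_def is_model_def by blast+

lemma copy_finite: "finite (C i j)"
  using copy_bij M_finite bij_betw_finite by blast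

lemma copy_inj: "c \<in> C i j \<Longrightarrow> d \<in> C i j \<Longrightarrow> e i j c = e i j d \<Longrightarrow> c = d"
  by (rule inj_onD[OF bij_betw_imp_inj_on[OF copy_bij]])

lemma copy_surj: "y \<in> univ (M i) \<Longrightarrow> \<exists>c \<in> C i j. e i j c = y"
  unfolding bij_betw_imp_surj_on[OF copy_bij, of i j, symmetric] by blast

lemma mem_copy_iff: "c \<in> C i j \<Longrightarrow> c \<in> C i' j' \<longleftrightarrow> i' = i \<and> j' = j"
  using copies_disjoint[of i j i' j'] by blast

text \<open>The last clause makes every named copy a union of connected components.\<close>

definition T_model :: "('u, 'c) struc \<Rightarrow> bool" where
  "T_model A \<longleftrightarrow> is_struc (\<Union>i j. C i j) A \<and> forest A \<and> inj_on (cst A) (\<Union>i j. C i j) \<and>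
     (\<forall>i j. \<forall>c \<in> C i j. \<forall>k. cst A c \<in> prd A k \<longleftrightarrow> e i j c \<in> prd (M i) k) \<and>
     (\<forall>i j. \<forall>c \<in> C i j. \<forall>d \<in> C i j. \<forall>k. (cst A c, cst A d) \<in> lt A k \<longleftrightarrow> (e i j c, e i j d) \<in> lt (M i) k) \<and>
     (\<forall>i j k x y. x \<in> cst A ` C i j \<longrightarrow> (x, y) \<in> lt A k \<or> (y, x) \<in> lt A k \<longrightarrow> y \<in> cst A ` C i j)"

lemma T_modelD:
  assumes "T_model A"
  shows "is_struc (\<Union>i j. C i j) A" "forest A" "inj_on (cst A) (\<Union>i j. C i j)"
  using assms unfolding T_model_def by simp_all

lemma T_model_cst: "T_model A \<Longrightarrow> c \<in> C i j \<Longrightarrow> cst A c \<in> univ A"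
  using T_modelD(1)[of A] unfolding is_struc_def by simp

lemma T_model_cst_prd: "T_model A \<Longrightarrow> c \<in> C i j \<Longrightarrow> cst A c \<in> prd A k \<longleftrightarrow> e i j c \<in> prd (M i) k"
  unfolding T_model_def by simp

lemma T_model_cst_lt:
  "T_model A \<Longrightarrow> c \<in> C i j \<Longrightarrow> d \<in> C i j \<Longrightarrow>
    (cst A c, cst A d) \<in> lt A k \<longleftrightarrow> (e i j c, e i j d) \<in> lt (M i) k"
  unfolding T_model_def by simp

lemma T_model_closed:
  assumes "T_model A" "x \<in> cst A ` C i j" "(x, y) \<in> lt A k \<or> (y, x) \<in> lt A k"
  shows "y \<in> cst A ` C i j"
proof -
  have "\<forall>i j k x y. x \<in> cst A ` C i j \<longrightarrow> (x, y) \<in> lt A k \<or> (y, x) \<in> lt A k \<longrightarrow> y \<in> cst A ` C i j"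
    using assms(1) unfolding T_model_def by (elim conjE)
  then show ?thesis using assms(2,3) by blast
qed

lemma holds_closed_axiom:
  assumes "is_struc (\<Union>i j. C i j) A" "set cs = C i j"
  shows "holds A (closed_axiom cs k) \<longleftrightarrow>
    (\<forall>x y. x \<in> cst A ` C i j \<longrightarrow> (x, y) \<in> lt A k \<or> (y, x) \<in> lt A k \<longrightarrow> y \<in> cst A ` C i j)"
proof (rule holds_iff[OF assms(1)])
  fix v
  have "sat A v (closed_axiom cs k) \<longleftrightarrow> (\<forall>x \<in> univ A. \<forall>y \<in> univ A. x \<in> cst A ` C i j \<longrightarrow>
      (x, y) \<in> lt A k \<or> (y, x) \<in> lt A k \<longrightarrow> y \<in> cst A ` C i j)"
    unfolding closed_axiom_def by (simp add: sat_one_of assms(2)) blast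
  \<comment> \<open>Both ends of an edge lie in the universe, so the bounds on the quantifiers can
    go.\<close>
  also have "\<dots> \<longleftrightarrow> (\<forall>x y. x \<in> cst A ` C i j \<longrightarrow>
      (x, y) \<in> lt A k \<or> (y, x) \<in> lt A k \<longrightarrow> y \<in> cst A ` C i j)"
    using is_struc_lt_univ[OF assms(1)] by blast
  finally show "sat A v (closed_axiom cs k) \<longleftrightarrow> \<dots>" .
qed

lemma is_model_T_iff:
  fixes A :: "('u, 'c) struc"
  shows "is_model (\<Union>i j. C i j) (T_theory M C e) A \<longleftrightarrow> T_model A"
proof (cases "is_struc (\<Union>i j. C i j) A")
  case s: True
  let ?K = "\<Union>i j. C i j"
  have neq: "holds A (Neg (Eq (Cst c) (Cst d))) \<longleftrightarrow> cst A c \<noteq> cst A d" for c d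
    by (rule holds_iff[OF s]) simp
  have pr: "holds A (lit b (Pr k (Cst c))) \<longleftrightarrow> (cst A c \<in> prd A k \<longleftrightarrow> b)" for b c k
    by (rule holds_lit[OF s]) simp
  have lts: "holds A (lit b (Lt k (Cst c) (Cst d))) \<longleftrightarrow> ((cst A c, cst A d) \<in> lt A k \<longleftrightarrow> b)" for b c d k
    by (rule holds_lit[OF s]) simp
  have "(\<forall>\<phi> \<in> {Neg (Eq (Cst c) (Cst d)) | c d. c \<in> ?K \<and> d \<in> ?K \<and> c \<noteq> d}. holds A \<phi>) \<longleftrightarrow>
      (\<forall>c d. c \<in> ?K \<and> d \<in> ?K \<and> c \<noteq> d \<longrightarrow> holds A (Neg (Eq (Cst c) (Cst d))))"
    by blast
  then have 1: "(\<forall>\<phi> \<in> {Neg (Eq (Cst c) (Cst d)) | c d. c \<in> ?K \<and> d \<in> ?K \<and> c \<noteq> d}. holds A \<phi>) \<longleftrightarrow>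
      inj_on (cst A) ?K"
    unfolding neq inj_on_def by blast
  have dia: "(\<forall>\<phi> \<in> diagram (M i) (C i j) (e i j). holds A \<phi>) \<longleftrightarrow>
      (\<forall>c \<in> C i j. \<forall>k. cst A c \<in> prd A k \<longleftrightarrow> e i j c \<in> prd (M i) k) \<and>
      (\<forall>c \<in> C i j. \<forall>d \<in> C i j. \<forall>k. (cst A c, cst A d) \<in> lt A k \<longleftrightarrow> (e i j c, e i j d) \<in> lt (M i) k)" for i j
  proof -
    have "(\<forall>\<phi> \<in> {lit (e i j c \<in> prd (M i) k) (Pr k (Cst c)) | k c. c \<in> C i j}. holds A \<phi>) \<longleftrightarrow>
        (\<forall>c \<in> C i j. \<forall>k. holds A (lit (e i j c \<in> prd (M i) k) (Pr k (Cst c))))"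
      by blast
    moreover have "(\<forall>\<phi> \<in> {lit ((e i j c, e i j d) \<in> lt (M i) k) (Lt k (Cst c) (Cst d)) | k c d.
          c \<in> C i j \<and> d \<in> C i j}. holds A \<phi>) \<longleftrightarrow>
        (\<forall>c \<in> C i j. \<forall>d \<in> C i j. \<forall>k. holds A (lit ((e i j c, e i j d) \<in> lt (M i) k) (Lt k (Cst c) (Cst d))))"
      by blast
    ultimately show ?thesis unfolding diagram_def ball_Un pr lts by (rule arg_cong2[where f = "(\<and>)"])
  qed
  have "(\<forall>\<phi> \<in> (\<Union>i j. diagram (M i) (C i j) (e i j)). holds A \<phi>) \<longleftrightarrow>
      (\<forall>i j. \<forall>\<phi> \<in> diagram (M i) (C i j) (e i j). holds A \<phi>)"
    by simp
  then have 2: "(\<forall>\<phi> \<in> (\<Union>i j. diagram (M i) (C i j) (e i j)). holds A \<phi>) \<longleftrightarrow>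
      (\<forall>i j. \<forall>c \<in> C i j. \<forall>k. cst A c \<in> prd A k \<longleftrightarrow> e i j c \<in> prd (M i) k) \<and>
      (\<forall>i j. \<forall>c \<in> C i j. \<forall>d \<in> C i j. \<forall>k.
        (cst A c, cst A d) \<in> lt A k \<longleftrightarrow> (e i j c, e i j d) \<in> lt (M i) k)"
    unfolding dia all_conj_distrib .
  \<comment> \<open>Copies are finite, so each has an enumeration and its closure axioms are really
    present in the theory.\<close>
  have ex: "\<exists>cs. distinct cs \<and> set cs = C i j" for i j
    using finite_distinct_list[OF copy_finite] by blast
  have "(\<forall>\<phi> \<in> {closed_axiom cs k | i j k cs. distinct cs \<and> set cs = C i j}. holds A \<phi>) \<longleftrightarrow>
      (\<forall>i j k cs. distinct cs \<longrightarrow> set cs = C i j \<longrightarrow> holds A (closed_axiom cs k))"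
    by blast
  also have "\<dots> \<longleftrightarrow> (\<forall>i j k cs. distinct cs \<longrightarrow> set cs = C i j \<longrightarrow>
      (\<forall>x y. x \<in> cst A ` C i j \<longrightarrow> (x, y) \<in> lt A k \<or> (y, x) \<in> lt A k \<longrightarrow> y \<in> cst A ` C i j))"
    using holds_closed_axiom[OF s] by simp
  also have "\<dots> \<longleftrightarrow>
      (\<forall>i j k x y. x \<in> cst A ` C i j \<longrightarrow> (x, y) \<in> lt A k \<or> (y, x) \<in> lt A k \<longrightarrow> y \<in> cst A ` C i j)"
    using ex by (intro iff_allI) blast
  finally have 3: "(\<forall>\<phi> \<in> {closed_axiom cs k | i j k cs. distinct cs \<and> set cs = C i j}. holds A \<phi>) \<longleftrightarrow>
      (\<forall>i j k x y. x \<in> cst A ` C i j \<longrightarrow> (x, y) \<in> lt A k \<or> (y, x) \<in> lt A k \<longrightarrow> y \<in> cst A ` C i j)" .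
  show ?thesis
    unfolding is_model_def T_model_def T_theory_def ball_Un 1 2 3 holds_T0_iff_forest[OF s] conj_assoc ..
qed (simp add: is_model_def T_model_def)

section \<open>The model formed by the constants\<close>

text \<open>The disjoint union of all copies, each with the relations pulled back along
  \<open>e i j\<close>; every constant names itself.\<close>

definition const_struc :: "('c, 'c) struc" where
  "const_struc = \<lparr>univ = (\<Union>i j. C i j),
     prd = (\<lambda>k. {c. \<exists>i j. c \<in> C i j \<and> e i j c \<in> prd (M i) k}),
     lt = (\<lambda>k. {(c, d). \<exists>i j. c \<in> C i j \<and> d \<in> C i j \<and> (e i j c, e i j d) \<in> lt (M i) k}),
     cst = (\<lambda>c. c)\<rparr>"

lemma const_struc_simps [simp]: "univ const_struc = (\<Union>i j. C i j)" "cst const_struc = (\<lambda>c. c)"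
  by (simp_all add: const_struc_def)

lemma const_struc_prd: "c \<in> C i j \<Longrightarrow> c \<in> prd const_struc k \<longleftrightarrow> e i j c \<in> prd (M i) k"
  by (simp add: const_struc_def mem_copy_iff)

lemma const_struc_lt:
  "c \<in> C i j \<Longrightarrow> (c, d) \<in> lt const_struc k \<longleftrightarrow> d \<in> C i j \<and> (e i j c, e i j d) \<in> lt (M i) k"
  "d \<in> C i j \<Longrightarrow> (c, d) \<in> lt const_struc k \<longleftrightarrow> c \<in> C i j \<and> (e i j c, e i j d) \<in> lt (M i) k"
  by (simp_all add: const_struc_def mem_copy_iff)

text \<open>Edges stay within one copy, so each condition reduces to the forest
  \<open>M i\<close>.\<close>

lemma T_model_const_struc: "T_model const_struc"
proof -
  have univ_C: "\<exists>i j. c \<in> C i j" if "c \<in> prd const_struc k" for c k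
    using that unfolding const_struc_def by auto
  have lt_C: "\<exists>i j. c \<in> C i j \<and> d \<in> C i j" if "(c, d) \<in> lt const_struc k" for c d k
    using that unfolding const_struc_def by auto
  have "univ (M 0) \<noteq> {}" using M_struc unfolding is_struc_def by blast
  then have "C 0 0 \<noteq> {}" using copy_bij[of 0 0] unfolding bij_betw_def by blast
  then have s: "is_struc (\<Union>i j. C i j) const_struc"
    unfolding is_struc_def by (auto simp: const_struc_def)
  have "forest const_struc"
    unfolding forest_def
  proof (intro conjI allI impI ballI subsetI)
    fix k l :: nat assume "k \<noteq> l"
    then have "c \<notin> prd const_struc l" if "c \<in> prd const_struc k" for c
      using univ_C[OF that] that const_struc_prd[of c] forest_level[OF M_forest] by blast
    then show "prd const_struc k \<inter> prd const_struc l = {}" by blast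
  next
    fix k p assume p: "p \<in> lt const_struc k"
    obtain c d where cd: "p = (c, d)" by (cases p)
    then obtain i j where "c \<in> C i j" "d \<in> C i j" using lt_C p by blast
    then show "p \<in> prd const_struc k \<times> prd const_struc (Suc k)"
      using p forest_lt[OF M_forest, of "e i j c" "e i j d" i k] const_struc_lt(1)[of c i j d k]
        const_struc_prd[of c i j] const_struc_prd[of d i j] cd by auto
  next
    fix k c assume c: "c \<in> prd const_struc (Suc k)"
    then obtain i j where ij: "c \<in> C i j" using univ_C by blast
    then have "e i j c \<in> prd (M i) (Suc k)" using c const_struc_prd by blast
    then obtain y where y: "(y, e i j c) \<in> lt (M i) k" using forest_parent[OF M_forest] by blast
    then have "y \<in> univ (M i)" using is_struc_lt_univ[OF M_struc] by blast
    then obtain d where "d \<in> C i j" "e i j d = y" using copy_surj[of y i j] by blast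
    then show "\<exists>d. (d, c) \<in> lt const_struc k" using y ij const_struc_lt by blast
  next
    fix k c c' d assume h: "(c, d) \<in> lt const_struc k" "(c', d) \<in> lt const_struc k"
    then obtain i j where ij: "c \<in> C i j" "d \<in> C i j" using lt_C by blast
    then have "c' \<in> C i j" "(e i j c, e i j d) \<in> lt (M i) k" "(e i j c', e i j d) \<in> lt (M i) k"
      using h const_struc_lt by blast+
    moreover have "e i j c = e i j c'" using forest_parent_unique[OF M_forest calculation(2,3)] by blast
    ultimately show "c = c'" using copy_inj[of c i j c'] ij by simp
  qed
  moreover have "y \<in> C i j" if "x \<in> C i j" "(x, y) \<in> lt const_struc k \<or> (y, x) \<in> lt const_struc k" for i j k x y
    using that const_struc_lt by blast
  ultimately show ?thesis
    unfolding T_model_def using s by (simp add: const_struc_prd const_struc_lt inj_on_def)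
qed

lemma T_model_map:
  assumes A: "T_model A" and g: "inj_on g (univ A)"
  shows "T_model (map_struc g A)"
proof -
  note s = T_modelD(1)[OF A] and f = T_modelD(2)[OF A] and inj = T_modelD(3)[OF A] and cst = T_model_cst[OF A]
  note prd = map_struc_prd[OF s g] and lt = map_struc_lt[OF s g]
  have "inj_on (\<lambda>c. g (cst A c)) (\<Union>i j. C i j)"
    using comp_inj_on[OF inj inj_on_subset[OF g]] cst by (auto simp: comp_def)
  moreover have "y \<in> cst (map_struc g A) ` C i j"
    if x: "x \<in> cst (map_struc g A) ` C i j" and xy: "(x, y) \<in> lt (map_struc g A) k \<or> (y, x) \<in> lt (map_struc g A) k"
    for i j k x y
  proof -
    obtain c where c: "c \<in> C i j" "x = g (cst A c)" using x by auto
    have "y \<in> g ` univ A"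
      using xy is_struc_lt_univ[OF is_struc_map[OF s, of g]] by auto
    then obtain b where b: "b \<in> univ A" "y = g b" by blast
    then have "(cst A c, b) \<in> lt A k \<or> (b, cst A c) \<in> lt A k"
      using xy lt cst[OF c(1)] c(2) by blast
    then have "b \<in> cst A ` C i j" using T_model_closed[OF A, of "cst A c"] c(1) by blast
    then show ?thesis using b(2) by auto
  qed
  ultimately show ?thesis
    using is_struc_map[OF s, of g] forest_map[OF s g f] A prd lt cst
    unfolding T_model_def by simp
qed

text \<open>The constants are a countable union of finite sets, so \<open>const_struc\<close> can be
  moved to natural numbers.\<close>

lemma T_model_nat: "\<exists>A :: (nat, 'c) struc. T_model A"
proof -
  have "countable (\<Union>i j. C i j)" using copy_finite by (simp add: countable_finite)
  then have "inj_on (to_nat_on (\<Union>i j. C i j)) (univ const_struc)" by (simp add: inj_on_to_nat_on)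
  then show ?thesis using T_model_map[OF T_model_const_struc] by blast
qed

section \<open>Infinitely many twins in every model\<close>

lemma alike_trans: "alike n k A B a b \<Longrightarrow> alike n k B D b d \<Longrightarrow> alike n k A D a d"
  unfolding alike_def by simp

text \<open>The image of \<open>S\<close> is closed under children in \<open>B\<close>, so
  \<open>h\<close> maps child sets onto child sets and \<open>ty_iso\<close> applies.\<close>

lemma alike_embedding:
  assumes "inj_on h S" and S: "\<And>x. x \<in> S \<Longrightarrow> children A x \<subseteq> S"
    and closed: "\<And>x y i. x \<in> S \<Longrightarrow> (h x, y) \<in> lt B i \<Longrightarrow> y \<in> h ` S"
    and prd: "\<And>x i. x \<in> S \<Longrightarrow> h x \<in> prd B i \<longleftrightarrow> x \<in> prd A i"
    and lt: "\<And>x y i. x \<in> S \<Longrightarrow> y \<in> S \<Longrightarrow> (h x, h y) \<in> lt B i \<longleftrightarrow> (x, y) \<in> lt A i"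
    and a: "a \<in> S"
  shows "alike n k A B a (h a)"
proof -
  have "children B (h x) = h ` children A x" if x: "x \<in> S" for x
  proof
    show "children B (h x) \<subseteq> h ` children A x"
    proof
      fix y assume "y \<in> children B (h x)"
      then obtain i where i: "(h x, y) \<in> lt B i" unfolding children_def by blast
      then obtain z where z: "z \<in> S" "y = h z" using closed[OF x] by blast
      then have "z \<in> children A x" using i lt[OF x z(1)] unfolding children_def by blast
      then show "y \<in> h ` children A x" using z(2) by blast
    qed
    show "h ` children A x \<subseteq> children B (h x)"
    proof
      fix y assume "y \<in> h ` children A x"
      then obtain z where z: "z \<in> children A x" "y = h z" by blast
      then have "z \<in> S" using S[OF x] by blast
      then show "y \<in> children B (h x)" using z lt[OF x] unfolding children_def by blast
    qed
  qed
  then have "ty n (children B) d (h a) = ty n (children A) d a" for d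
    using assms(1) S a by (intro ty_iso[where S = S]) blast+
  then show ?thesis unfolding alike_def by (simp add: prd[OF a])
qed

text \<open>The closure axioms make the interpretation of the constants an embedding of
  \<open>const_struc\<close> with child-closed image.\<close>

lemma alike_const:
  assumes A: "T_model A" and c: "c \<in> C i j"
  shows "alike n k const_struc A c (cst A c)"
proof (rule alike_embedding[where S = "\<Union>i j. C i j"])
  show "inj_on (cst A) (\<Union>i j. C i j)" by (rule T_modelD(3)[OF A])
next
  fix x assume "x \<in> (\<Union>i j. C i j)"
  show "children const_struc x \<subseteq> (\<Union>i j. C i j)"
    by (auto simp: children_def const_struc_def)
next
  fix x y l assume x: "x \<in> (\<Union>i j. C i j)" and y: "(cst A x, y) \<in> lt A l"
  obtain i j where "x \<in> C i j" using x by blast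
  then have "y \<in> cst A ` C i j" using T_model_closed[OF A, of "cst A x"] y by blast
  then show "y \<in> cst A ` (\<Union>i j. C i j)" by blast
next
  fix x l assume "x \<in> (\<Union>i j. C i j)"
  then obtain i j where "x \<in> C i j" by blast
  then show "cst A x \<in> prd A l \<longleftrightarrow> x \<in> prd const_struc l"
    by (simp add: const_struc_prd T_model_cst_prd[OF A])
next
  fix x y l assume "x \<in> (\<Union>i j. C i j)" and y: "y \<in> (\<Union>i j. C i j)"
  then obtain i j where x: "x \<in> C i j" by blast
  show "(cst A x, cst A y) \<in> lt A l \<longleftrightarrow> (x, y) \<in> lt const_struc l"
  proof (cases "y \<in> C i j")
    case True
    then show ?thesis by (simp add: const_struc_lt(1)[OF x] T_model_cst_lt[OF A x])
  next
    \<comment> \<open>An edge would pull \<open>cst A y\<close> into the copy of \<open>x\<close>,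
      which injectivity of the constants forbids.\<close>
    case False
    have "cst A y \<notin> cst A ` C i j"
      using inj_on_image_mem_iff[OF T_modelD(3)[OF A] y, of "C i j"] False by blast
    then have "(cst A x, cst A y) \<notin> lt A l" using T_model_closed[OF A, of "cst A x"] x by blast
    then show ?thesis using False const_struc_lt(1)[OF x] by blast
  qed
next
  show "c \<in> (\<Union>i j. C i j)" using c by blast
qed

text \<open>A copy of \<open>G\<close> on natural numbers is isomorphic to some \<open>M i\<close>;
  this \<open>i\<close> serves all \<open>j\<close>, which yields infinitely many disjoint
  copies.\<close>

lemma finite_forest_copies:
  fixes G :: "('g, 'c) struc"
  assumes s: "is_struc {} G" and G: "forest G" and fin: "finite (univ G)"
  shows "\<exists>i. \<forall>j. \<exists>h. bij_betw h (univ G) (C i j) \<and>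
    (\<forall>a \<in> univ G. \<forall>k. h a \<in> prd const_struc k \<longleftrightarrow> a \<in> prd G k) \<and>
    (\<forall>a \<in> univ G. \<forall>b \<in> univ G. \<forall>k. (h a, h b) \<in> lt const_struc k \<longleftrightarrow> (a, b) \<in> lt G k)"
proof -
  obtain g :: "'g \<Rightarrow> nat" where g: "inj_on g (univ G)"
    using finite_imp_inj_to_nat_seg[OF fin] by blast
  let ?G = "map_struc g G"
  have "finite_model_T0 ?G"
    unfolding finite_model_T0_def is_model_def
    using holds_T0_iff_forest[OF is_struc_map[OF s, of g]] is_struc_map[OF s, of g] forest_map[OF s g G] fin
    by simp
  then obtain i where "isomorphic0 ?G (M i)"
    using listing unfolding lists_finite_models_def by blast
  then obtain f where f: "bij_betw f (univ ?G) (univ (M i))"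
    and fprd: "\<forall>k. \<forall>a\<in>univ ?G. a \<in> prd ?G k \<longleftrightarrow> f a \<in> prd (M i) k"
    and flt: "\<forall>k. \<forall>a\<in>univ ?G. \<forall>b\<in>univ ?G. (a, b) \<in> lt ?G k \<longleftrightarrow> (f a, f b) \<in> lt (M i) k"
    unfolding isomorphic0_def by blast
  have fg: "bij_betw (f \<circ> g) (univ G) (univ (M i))"
    using bij_betw_trans[OF inj_on_imp_bij_betw[OF g]] f by simp
  show ?thesis
  proof (intro exI[of _ i] allI)
    fix j
    define h where "h = inv_into (C i j) (e i j) \<circ> (f \<circ> g)"
    have h: "bij_betw h (univ G) (C i j)"
      unfolding h_def by (rule bij_betw_trans[OF fg bij_betw_inv_into[OF copy_bij]])
    have hC: "h a \<in> C i j" if "a \<in> univ G" for a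
      using bij_betwE[OF h] that by blast
    have eh: "e i j (h a) = f (g a)" if "a \<in> univ G" for a
      unfolding h_def using bij_betw_inv_into_right[OF copy_bij, of "f (g a)" i j] bij_betwE[OF fg] that by simp
    have "h a \<in> prd const_struc k \<longleftrightarrow> a \<in> prd G k" if "a \<in> univ G" for a k
      using const_struc_prd[OF hC[OF that]] eh that fprd map_struc_prd[OF s g that] by simp
    moreover have "(h a, h b) \<in> lt const_struc k \<longleftrightarrow> (a, b) \<in> lt G k" if "a \<in> univ G" "b \<in> univ G" for a b k
      using const_struc_lt(1)[OF hC[OF that(1)]] hC eh that flt map_struc_lt[OF s g that] by simp
    ultimately show "\<exists>h. bij_betw h (univ G) (C i j) \<and>
      (\<forall>a \<in> univ G. \<forall>k. h a \<in> prd const_struc k \<longleftrightarrow> a \<in> prd G k) \<and>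
      (\<forall>a \<in> univ G. \<forall>b \<in> univ G. \<forall>k. (h a, h b) \<in> lt const_struc k \<longleftrightarrow> (a, b) \<in> lt G k)"
      using h by blast
  qed
qed

text \<open>Each \<open>j\<close> contributes one twin of \<open>a\<close>; the twins differ because
  copies are disjoint and constants have distinct values.\<close>

lemma infinite_alike:
  fixes G :: "('g, 'c) struc"
  assumes A: "T_model A" and s: "is_struc {} G" and G: "forest G" and fin: "finite (univ G)"
    and a: "a \<in> univ G"
  shows "infinite {b \<in> univ A. alike n k G A a b}"
proof -
  let ?iso = "\<lambda>i j h. bij_betw h (univ G) (C i j) \<and>
    (\<forall>a \<in> univ G. \<forall>k. h a \<in> prd const_struc k \<longleftrightarrow> a \<in> prd G k) \<and>
    (\<forall>a \<in> univ G. \<forall>b \<in> univ G. \<forall>k. (h a, h b) \<in> lt const_struc k \<longleftrightarrow> (a, b) \<in> lt G k)"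
  obtain i where "\<forall>j. \<exists>h. ?iso i j h"
    using finite_forest_copies[OF s G fin] by blast
  from choice[OF this] obtain h where h: "\<forall>j. ?iso i j (h j)" ..
  have bij: "bij_betw (h j) (univ G) (C i j)" for j using h by blast
  have hC: "h j x \<in> C i j" if "x \<in> univ G" for j x using bij_betwE[OF bij] that by blast
  have "alike n k G const_struc a (h j a)" for j
  proof (rule alike_embedding[where S = "univ G"])
    show "inj_on (h j) (univ G)" by (rule bij_betw_imp_inj_on[OF bij])
    show "children G x \<subseteq> univ G" for x
      using is_struc_lt_univ(2)[OF s] unfolding children_def by blast
    show "y \<in> h j ` univ G" if "x \<in> univ G" "(h j x, y) \<in> lt const_struc l" for x y l
      unfolding bij_betw_imp_surj_on[OF bij] using const_struc_lt(1)[OF hC[OF that(1)]] that(2) by blast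
    show "h j x \<in> prd const_struc l \<longleftrightarrow> x \<in> prd G l" if "x \<in> univ G" for x l
      using h that by blast
    show "(h j x, h j y) \<in> lt const_struc l \<longleftrightarrow> (x, y) \<in> lt G l" if "x \<in> univ G" "y \<in> univ G" for x y l
      using h that by blast
  qed (rule a)
  then have "alike n k G A a (cst A (h j a))" for j
    using alike_const[OF A hC[OF a]] by (rule alike_trans)
  moreover have "cst A (h j a) \<in> univ A" for j
    by (rule T_model_cst[OF A hC[OF a]])
  ultimately have sub: "range (\<lambda>j. cst A (h j a)) \<subseteq> {b \<in> univ A. alike n k G A a b}" by blast
  have "inj (\<lambda>j. cst A (h j a))"
  proof (rule injI)
    fix j l assume eq: "cst A (h j a) = cst A (h l a)"
    have "h j a \<in> (\<Union>i j. C i j)" "h l a \<in> (\<Union>i j. C i j)" using hC[OF a] by blast+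
    then have "h j a = h l a" using inj_on_eq_iff[OF T_modelD(3)[OF A]] eq by blast
    then have "h j a \<in> C i j" "h j a \<in> C i l" using hC[OF a, of j] hC[OF a, of l] by auto
    then show "j = l" using mem_copy_iff[of "h j a" i j i l] by blast
  qed
  then have "infinite (range (\<lambda>j. cst A (h j a)))" by (rule range_inj_infinite)
  then show ?thesis using sub infinite_super by blast
qed

text \<open>A root is replaced by the root of its finite pruned tree, and an element on no level up
  to \<open>k\<close> by an isolated point; both are finite forests, covered by
  \<open>infinite_alike\<close>.\<close>

lemma T_model_rich:
  fixes A :: "('u, 'c) struc"
  assumes s: "is_struc K A" and A: "forest A" and B: "T_model B"
  shows "rich n k A B"
  unfolding rich_def
proof (intro ballI impI)
  fix a assume a: "a \<in> univ A" and root: "\<forall>i<k. \<forall>c. (c, a) \<notin> lt A i"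
  show "infinite {b \<in> univ B. alike n k A B a b}"
  proof (cases "a \<in> prd A 0")
    case True
    obtain F where F: "finite F" "a \<in> F" "F \<subseteq> (\<Union>i. prd A i)"
      and up: "\<forall>i y z. y \<in> F \<longrightarrow> (z, y) \<in> lt A i \<longrightarrow> z \<in> F"
      and tyF: "ty n (\<lambda>z. children A z \<inter> F) k a = ty n (children A) k a"
      using forest_prune[OF A True, of n k] by blast
    define G :: "('u, 'c) struc" where
      "G = \<lparr>univ = F, prd = (\<lambda>i. prd A i \<inter> F), lt = (\<lambda>i. lt A i \<inter> F \<times> F), cst = cst A\<rparr>"
    have G_simps: "univ G = F" "prd G i = prd A i \<inter> F" "lt G i = lt A i \<inter> F \<times> F" for i
      by (simp_all add: G_def)
    have "is_struc {} G" unfolding is_struc_def G_simps using F(2) by auto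
    moreover have "forest G"
      unfolding forest_def
    proof (intro conjI allI impI ballI)
      fix i j :: nat assume "i \<noteq> j"
      then show "prd G i \<inter> prd G j = {}" using forest_level[OF A] unfolding G_simps by auto
    next
      fix i show "lt G i \<subseteq> prd G i \<times> prd G (Suc i)" using forest_lt[OF A] unfolding G_simps by auto
    next
      fix i x assume "x \<in> prd G (Suc i)"
      then have x: "x \<in> prd A (Suc i)" "x \<in> F" unfolding G_simps by auto
      obtain y where "(y, x) \<in> lt A i" using forest_parent[OF A x(1)] by blast
      then show "\<exists>y. (y, x) \<in> lt G i" using up x(2) unfolding G_simps by auto
    next
      fix i x x' y assume "(x, y) \<in> lt G i" "(x', y) \<in> lt G i"
      then show "x = x'" using forest_parent_unique[OF A, of x y i x' i] unfolding G_simps by auto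
    qed
    ultimately have inf: "infinite {b \<in> univ B. alike n k G B a b}"
      using F G_simps(1) by (intro infinite_alike[OF B]) simp_all
    \<comment> \<open>This also holds at \<open>z\<close> outside \<open>F\<close>: such a
      \<open>z\<close> has no child in \<open>F\<close>, since \<open>F\<close> contains the parents
      of its elements.\<close>
    have "children G = (\<lambda>z. children A z \<inter> F)"
      using up unfolding children_def G_simps by (auto simp: fun_eq_iff)
    moreover have "a \<in> prd A i \<longleftrightarrow> i = 0" for i using forest_level[OF A True] True by blast
    ultimately have "alike n k A G a a"
      unfolding alike_def G_simps using F(2) tyF by simp
    then have "{b \<in> univ B. alike n k G B a b} \<subseteq> {b \<in> univ B. alike n k A B a b}"
      using alike_trans[of n k A G a a B] by blast
    then show ?thesis using inf infinite_super by blast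
  next
    case False
    \<comment> \<open>A level from 1 to \<open>k\<close> would give \<open>a\<close> a parent
      through an index below \<open>k\<close>.\<close>
    have no_level: "a \<notin> prd A i" if "i \<le> k" for i
    proof (cases i)
      case 0 then show ?thesis using False by simp
    next
      case (Suc l) then show ?thesis using root that forest_parent[OF A, of a l] by auto
    qed
    define G :: "(unit, 'c) struc" where
      "G = \<lparr>univ = {()}, prd = (\<lambda>i. {}), lt = (\<lambda>i. {}), cst = (\<lambda>c. ())\<rparr>"
    have "is_struc {} G" "forest G" unfolding is_struc_def forest_def G_def by auto
    then have inf: "infinite {b \<in> univ B. alike n k G B () b}"
      by (intro infinite_alike[OF B]) (simp_all add: G_def)
    have "alike n k A G a ()" unfolding alike_def G_def using no_level by simp
    then have "{b \<in> univ B. alike n k G B () b} \<subseteq> {b \<in> univ B. alike n k A B a b}"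
      using alike_trans[of n k A G a "()" B] by blast
    then show ?thesis using inf infinite_super by blast
  qed
qed

section \<open>Agreement of any two models\<close>

text \<open>Whole copies are taken, not single constants, since a position must be closed under
  parents; copies are, by the closure axioms.\<close>

lemma position_constants:
  assumes A: "T_model A" and B: "T_model B" and I: "finite I"
  shows "position n k A B ((\<lambda>c. (cst A c, cst B c)) ` (\<Union>(i, j) \<in> I. C i j))" (is "position n k A B (?p ` ?S)")
proof -
  have cstA: "cst A c \<in> univ A" and cstB: "cst B c \<in> univ B" if "c \<in> C i j" for c i j
    using T_model_cst A B that by blast+
  have S: "\<exists>i j. c \<in> C i j \<and> C i j \<subseteq> ?S" if "c \<in> ?S" for c
    using that by blast
  note injA = T_modelD(3)[OF A] and injB = T_modelD(3)[OF B]
  have inj: "cst A c = cst A d \<longleftrightarrow> c = d" "cst B c = cst B d \<longleftrightarrow> c = d"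
    if "c \<in> C i j" "d \<in> C i' j'" for c d i j i' j'
    using inj_on_eq_iff[OF injA, of c d] inj_on_eq_iff[OF injB, of c d] that by blast+
  have lt: "(cst D c, cst D d) \<in> lt D l \<longleftrightarrow> d \<in> C i j \<and> (e i j c, e i j d) \<in> lt (M i) l"
    if D: "T_model D" and c: "c \<in> C i j" and d: "d \<in> C i' j'" for D :: "('x, 'c) struc" and c d i j i' j' l
  proof -
    have "d \<in> C i j" if "(cst D c, cst D d) \<in> lt D l"
    proof -
      have "cst D d \<in> cst D ` C i j" using T_model_closed[OF D, of "cst D c" i j] c that by blast
      then show ?thesis using inj_on_image_mem_iff[OF T_modelD(3)[OF D], of d "C i j"] d by blast
    qed
    then show ?thesis using T_model_cst_lt[OF D c] by blast
  qed
  have closed: "x \<in> cst D ` ?S" if D: "T_model D" and x: "(x, y) \<in> lt D l" "y \<in> cst D ` ?S"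
    for D :: "('x, 'c) struc" and x y l
  proof -
    obtain c where c: "c \<in> ?S" "y = cst D c" using x(2) by blast
    then obtain i j where ij: "c \<in> C i j" "C i j \<subseteq> ?S" using S by blast
    then have "x \<in> cst D ` C i j" using T_model_closed[OF D, of y i j x l] x(1) c(2) by blast
    then show ?thesis using ij(2) by blast
  qed
  have dom: "Domain (?p ` ?S) = cst A ` ?S" and ran: "Range (?p ` ?S) = cst B ` ?S" by force+
  show ?thesis
    unfolding position_def dom ran
  proof (intro conjI)
    show "finite (?p ` ?S)" using I by (intro finite_imageI finite_UN_I) (auto simp: copy_finite)
    show "?p ` ?S \<subseteq> univ A \<times> univ B" using cstA cstB by auto
    show "\<forall>a b. (a, b) \<in> ?p ` ?S \<longrightarrow> alike n k A B a b"
    proof (intro allI impI)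
      fix a b assume "(a, b) \<in> ?p ` ?S"
      then obtain c i j where c: "c \<in> C i j" "a = cst A c" "b = cst B c" by auto
      show "alike n k A B a b"
        \<comment> \<open>\<open>const_struc\<close> mediates: the constant itself is alike to both
          of its values.\<close>
        unfolding c(2,3) using alike_const[OF A c(1), of n k, unfolded alike_sym[of n k const_struc]]
        by (rule alike_trans) (rule alike_const[OF B c(1)])
    qed
    show "\<forall>a b a' b'. (a, b) \<in> ?p ` ?S \<longrightarrow> (a', b') \<in> ?p ` ?S \<longrightarrow>
        (a = a' \<longleftrightarrow> b = b') \<and> (\<forall>i<k. (a, a') \<in> lt A i \<longleftrightarrow> (b, b') \<in> lt B i)"
    proof (intro allI impI)
      fix a b a' b' assume "(a, b) \<in> ?p ` ?S" "(a', b') \<in> ?p ` ?S"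
      then obtain c i j c' i' j' where c: "c \<in> C i j" "a = cst A c" "b = cst B c"
        "c' \<in> C i' j'" "a' = cst A c'" "b' = cst B c'" by auto
      then show "(a = a' \<longleftrightarrow> b = b') \<and> (\<forall>i<k. (a, a') \<in> lt A i \<longleftrightarrow> (b, b') \<in> lt B i)"
        using inj[OF c(1,4)] lt[OF A c(1,4)] lt[OF B c(1,4)] by simp
    qed
    show "\<forall>i<k. \<forall>a a'. (a, a') \<in> lt A i \<longrightarrow> a' \<in> cst A ` ?S \<longrightarrow> a \<in> cst A ` ?S"
      using closed[OF A] by blast
    show "\<forall>i<k. \<forall>b b'. (b, b') \<in> lt B i \<longrightarrow> b' \<in> cst B ` ?S \<longrightarrow> b \<in> cst B ` ?S"
      using closed[OF B] by blast
  qed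
qed

lemma T_model_sat_iff:
  assumes A: "T_model A" and B: "T_model B" and \<phi>: "sentence (\<Union>i j. C i j) \<phi>"
  shows "sat A v \<phi> \<longleftrightarrow> sat B w \<phi>"
proof -
  have "\<forall>c \<in> set_fm \<phi>. \<exists>p. c \<in> C (fst p) (snd p)"
    using \<phi> unfolding sentence_def by fastforce
  then obtain f where f: "\<forall>c \<in> set_fm \<phi>. c \<in> C (fst (f c)) (snd (f c))" by (rule bchoice[THEN exE])
  \<comment> \<open>\<open>f\<close> picks the copy of each constant of \<open>\<phi>\<close>; the
    game starts from the union of these finitely many copies.\<close>
  let ?R = "(\<lambda>c. (cst A c, cst B c)) ` (\<Union>(i, j) \<in> f ` set_fm \<phi>. C i j)"
  define k where "k = level_bound \<phi>"
  \<comment> \<open>The cap is chosen after the starting position, just large enough for its size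
    and all quantifier moves.\<close>
  define n where "n = card ?R + qrank \<phi> * Suc k"
  have s: "is_struc (\<Union>i j. C i j) A" "is_struc (\<Union>i j. C i j) B" "forest A" "forest B"
    using T_modelD A B by blast+
  show ?thesis
  proof (rule position_sat_iff[of A B n k ?R])
    show "position n k A B ?R" by (rule position_constants[OF A B]) simp
    show "rich n k A B" "rich n k B A" using T_model_rich s A B by blast+
    show "lt A i \<subseteq> univ A \<times> univ A" "lt B i \<subseteq> univ B \<times> univ B" for i
      using s(1,2) unfolding is_struc_def by simp_all
    show "(cst A c, cst B c) \<in> ?R" if "c \<in> set_fm \<phi>" for c
    proof (rule imageI)
      show "c \<in> (\<Union>(i, j) \<in> f ` set_fm \<phi>. C i j)"
        using f that by (auto simp: case_prod_unfold)
    qed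
    show "(v x, w x) \<in> ?R" if "x \<in> free_vars \<phi>" for x
      using \<phi> that unfolding sentence_def by simp
  qed (simp_all add: s n_def k_def)
qed

end

theorem theorem5p14:
  fixes M :: "nat \<Rightarrow> ('m, 'c) struc"
    and C :: "nat \<Rightarrow> nat \<Rightarrow> 'c set"
    and e :: "nat \<Rightarrow> nat \<Rightarrow> 'c \<Rightarrow> 'm"
  assumes "lists_finite_models M"
    and "\<And>i j. bij_betw (e i j) (C i j) (univ (M i))"
    and "\<And>i j i' j'. (i, j) \<noteq> (i', j') \<Longrightarrow> C i j \<inter> C i' j' = {}"
  shows "complete_theory TYPE('u) (\<Union>i j. C i j) (T_theory M C e)"
proof -
  interpret finite_model_copies M C e by unfold_locales (fact assms)+
  obtain N :: "(nat, 'c) struc" where N: "T_model N" using T_model_nat by blast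
  have "entails TYPE('u) (\<Union>i j. C i j) (T_theory M C e) \<phi> \<or>
      entails TYPE('u) (\<Union>i j. C i j) (T_theory M C e) (Neg \<phi>)"
    if \<phi>: "sentence (\<Union>i j. C i j) \<phi>" for \<phi>
  \<comment> \<open>The countable model \<open>N\<close> decides \<open>\<phi>\<close> for all
    models over \<open>'u\<close>. The assignment is arbitrary, as \<open>\<phi>\<close> is a
    sentence.\<close>
  proof (cases "sat N (\<lambda>_. 0) \<phi>")
    case True
    then have "entails TYPE('u) (\<Union>i j. C i j) (T_theory M C e) \<phi>"
      unfolding entails_def is_model_T_iff holds_def using T_model_sat_iff[OF _ N \<phi>] by blast
    then show ?thesis ..
  next
    case False
    have "\<not> sat A v \<phi>" if "T_model A" for A :: "('u, 'c) struc" and v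
      using T_model_sat_iff[OF that N \<phi>] False by blast
    then have "entails TYPE('u) (\<Union>i j. C i j) (T_theory M C e) (Neg \<phi>)"
      unfolding entails_def is_model_T_iff holds_def by simp
    then show ?thesis ..
  qed
  then show ?thesis unfolding complete_theory_def is_model_T_iff using N by blast
qed

end
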